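(* Let $S$ be a set of primes. Then $$E[Lie^S](t)=\begin{cases} \displaystyle\prod_{ n\in P(S)} (1-t^n p_n)^{-1} \prod_{n\text{ even},\ \frac{n}{2}\in P(S)} (1-t^np_n), & 2\notin S,\\[2ex] \displaystyle\prod_{n\text{ odd},\ n\in P(S) } (1-t^np_n)^{-1}=\prod_{n\in P(S\setminus\{2\}) } (1-t^np_n)^{-1}, & 2\in S;\end{cases}$$ $$\omega(E[Lie^S])(t)= \prod_{ n\in P(S)} (1-t^n p_n)^{-1}\prod_{n\text{ even},\ \frac{n}{2}\in P(S)} (1+t^np_n),\qquad \text{provided } 2\notin S;$$ $$E[\omega(Lie^S)^{alt}](t)=\begin{cases} \displaystyle\prod_{ n\in P(S)} (1+t^n p_n) \prod_{n\text{ even},\ \frac{n}{2}\in P(S)} (1+t^np_n)^{-1}, & 2\notin S,\\[2ex] \displaystyle\prod_{n\text{ odd},\ n\in P(S) } (1+t^np_n), & 2\in S.\end{cases}$$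
   Context: $e_n,p_n$ are the elementary and power-sum symmetric functions, $\omega$ is the involution with $\omega(h_n)=e_n$ (acting on coefficients of $t^n$), $f[g]$ is plethysm. For a series $Q=\sum_{i\ge1}q_i$ with $q_i$ homogeneous of degree $i$: $E_\lambda[Q]=\prod_{i:m_i\ge1}e_{m_i}[q_i]$, where $m_i$ is the number of parts of $\lambda$ equal to $i$; $E[Q](t)=\sum_{\lambda}t^{|\lambda|}E_\lambda[Q]$, the sum over all partitions including the empty one (so the coefficient of $t^n$ is the degree $n$ term of $(\sum_{r\ge0}e_r)[Q]$); and $\omega(Q)^{alt}=\sum_{i\ge1}(-1)^{i-1}\omega(q_i)$. $P(S)$ is the set of positive integers all of whose prime factors lie in $S$ (so $1\in P(S)$). For $n\ge1$, let $Q_n$ be the largest divisor of $n$ lying in $P(S)$. Let $C_n\subset S_n$ be the cyclic group generated by an $n$-cycle. $Lie_n^S$ is the Frobenius characteristic of the $S_n$-module induced from the linear character of $C_n$ sending the generator to $\exp(\frac{2\pi i}{n}\cdot Q_n)$, and $Lie^S=\sum_{n\ge1}Lie^S_n$. *)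

theory Defs
  imports
    "HOL-Analysis.Analysis"
    "HOL-Library.Poly_Mapping"
    "HOL-Computational_Algebra.Formal_Power_Series"
    "HOL-Computational_Algebra.Primes"
    "HOL-Combinatorics.Orbits"
    "HOL-Algebra.Left_Coset"
    "HOL-Algebra.Sym_Groups"
begin

section \<open>The ring of symmetric functions\<close>

text \<open>
  A monomial in the variables \<open>x\<^sub>0, x\<^sub>1, x\<^sub>2, \<dots>\<close> is its exponent vector, of type \<open>nat \<Rightarrow>\<^sub>0 nat\<close>.
  A symmetric function over the complex numbers is a formal power series in these variables,
  given by its coefficients, that has bounded degree and is invariant under permuting the
  variables.
\<close>

definition monom_deg :: "(nat \<Rightarrow>\<^sub>0 nat) \<Rightarrow> nat" where
  "monom_deg m = (\<Sum>i\<in>Poly_Mapping.keys m. Poly_Mapping.lookup m i)"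

definition bounded_degree :: "((nat \<Rightarrow>\<^sub>0 nat) \<Rightarrow> complex) \<Rightarrow> bool" where
  "bounded_degree f \<longleftrightarrow> (\<exists>d. \<forall>m. f m \<noteq> 0 \<longrightarrow> monom_deg m \<le> d)"

definition symmetric :: "((nat \<Rightarrow>\<^sub>0 nat) \<Rightarrow> complex) \<Rightarrow> bool" where
  "symmetric f \<longleftrightarrow> (\<forall>\<pi> m. bij \<pi> \<longrightarrow> f (Poly_Mapping.map_key \<pi> m) = f m)"

typedef symfun = "{f. bounded_degree f \<and> symmetric f}"
  morphisms sf_coeff Abs_symfun
  by (rule exI[of _ "\<lambda>_. 0"]) (simp add: bounded_degree_def symmetric_def)

setup_lifting type_definition_symfun

lemma lookup_map_key_bij:
  "bij \<pi> \<Longrightarrow> Poly_Mapping.lookup (Poly_Mapping.map_key \<pi> m) i = Poly_Mapping.lookup m (\<pi> i)"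
  by (simp add: map_key.rep_eq bij_is_inj)

lemma monom_deg_superset:
  assumes "finite A" "Poly_Mapping.keys m \<subseteq> A"
  shows "monom_deg m = (\<Sum>i\<in>A. Poly_Mapping.lookup m i)"
  unfolding monom_deg_def
  by (rule sum.mono_neutral_left) (use assms in \<open>auto simp: in_keys_iff\<close>)

lemma monom_deg_add: "monom_deg (a + b) = monom_deg a + monom_deg b"
proof -
  let ?A = "Poly_Mapping.keys a \<union> Poly_Mapping.keys b"
  have "monom_deg (a + b) = (\<Sum>i\<in>?A. Poly_Mapping.lookup (a + b) i)"
    by (rule monom_deg_superset) (auto simp: in_keys_iff lookup_add)
  moreover have "monom_deg a = (\<Sum>i\<in>?A. Poly_Mapping.lookup a i)"
    by (rule monom_deg_superset) auto
  moreover have "monom_deg b = (\<Sum>i\<in>?A. Poly_Mapping.lookup b i)"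
    by (rule monom_deg_superset) auto
  ultimately show ?thesis by (simp add: lookup_add sum.distrib)
qed

lemma monom_deg_map_key:
  assumes "bij \<pi>"
  shows "monom_deg (Poly_Mapping.map_key \<pi> m) = monom_deg m"
proof -
  have "monom_deg (Poly_Mapping.map_key \<pi> m)
      = (\<Sum>i\<in>\<pi> -` Poly_Mapping.keys m. Poly_Mapping.lookup m (\<pi> i))"
    unfolding monom_deg_def using assms by (simp add: keys_map_key bij_is_inj lookup_map_key_bij)
  also have "\<dots> = (\<Sum>i\<in>\<pi> ` (\<pi> -` Poly_Mapping.keys m). Poly_Mapping.lookup m i)"
    by (rule sum.reindex[symmetric, unfolded comp_def])
      (use assms in \<open>auto simp: bij_def inj_on_def\<close>)
  also have "\<pi> ` (\<pi> -` Poly_Mapping.keys m) = Poly_Mapping.keys m"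
    using assms by (simp add: bij_is_surj)
  finally show ?thesis by (simp add: monom_deg_def)
qed

lemma map_key_inv:
  assumes "bij \<pi>"
  shows "Poly_Mapping.map_key (inv_into UNIV \<pi>) (Poly_Mapping.map_key \<pi> m) = m"
    and "Poly_Mapping.map_key \<pi> (Poly_Mapping.map_key (inv_into UNIV \<pi>) m) = m"
  using assms
  by (auto intro!: poly_mapping_eqI simp: lookup_map_key_bij bij_imp_bij_inv
      bij_is_surj surj_f_inv_f bij_is_inj inv_f_f)

lemma finite_monom_splittings: "finite {(a, b :: nat \<Rightarrow>\<^sub>0 nat). a + b = m}"
proof -
  let ?K = "Poly_Mapping.keys m"
  let ?N = "{a. \<forall>i. Poly_Mapping.lookup a i \<le> Poly_Mapping.lookup m i}"
  have "finite ?N"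
  proof (rule inj_on_finite)
    show "inj_on (\<lambda>a. restrict (Poly_Mapping.lookup a) ?K) ?N"
    proof (rule inj_onI, rule poly_mapping_eqI)
      fix a b i
      assume *: "a \<in> ?N" "b \<in> ?N"
        "restrict (Poly_Mapping.lookup a) ?K = restrict (Poly_Mapping.lookup b) ?K"
      show "Poly_Mapping.lookup a i = Poly_Mapping.lookup b i"
      proof (cases "i \<in> ?K")
        case True
        then show ?thesis using fun_cong[OF *(3), of i] by simp
      next
        case False
        then have "Poly_Mapping.lookup m i = 0" by (simp add: in_keys_iff)
        then show ?thesis using *(1,2) by (metis (mono_tags) le_zero_eq mem_Collect_eq)
      qed
    qed
    show "(\<lambda>a. restrict (Poly_Mapping.lookup a) ?K) ` ?N
        \<subseteq> (\<Pi>\<^sub>E i\<in>?K. {..Poly_Mapping.lookup m i})"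
      by auto
    show "finite (\<Pi>\<^sub>E i\<in>?K. {..Poly_Mapping.lookup m i})"
      by (rule finite_PiE) auto
  qed
  then have "finite (?N \<times> ?N)" by simp
  moreover have "{(a, b). a + b = m} \<subseteq> ?N \<times> ?N"
    by (auto simp: lookup_add)
  ultimately show ?thesis by (rule rev_finite_subset)
qed

instantiation symfun :: comm_ring_1
begin

lift_definition zero_symfun :: symfun is "\<lambda>_. 0"
  by (simp add: bounded_degree_def symmetric_def)

lift_definition one_symfun :: symfun is "\<lambda>m. if m = 0 then 1 else 0"
proof -
  have "Poly_Mapping.map_key \<pi> m = 0 \<longleftrightarrow> m = 0" if "bij \<pi>" for \<pi> :: "nat \<Rightarrow> nat" and m :: "nat \<Rightarrow>\<^sub>0 nat"
    using that map_key_inv(1)[of \<pi> m] by (metis bij_betw_def bij_imp_bij_inv map_key_zero)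
  then show "bounded_degree (\<lambda>m. if m = 0 then 1 else 0)
      \<and> symmetric (\<lambda>m. if m = 0 then 1 else 0)"
    by (auto simp: bounded_degree_def symmetric_def)
qed

lift_definition plus_symfun :: "symfun \<Rightarrow> symfun \<Rightarrow> symfun" is "\<lambda>f g m. f m + g m"
proof -
  fix f g :: "(nat \<Rightarrow>\<^sub>0 nat) \<Rightarrow> complex"
  assume *: "bounded_degree f \<and> symmetric f" "bounded_degree g \<and> symmetric g"
  then obtain d e where "\<forall>m. f m \<noteq> 0 \<longrightarrow> monom_deg m \<le> d" "\<forall>m. g m \<noteq> 0 \<longrightarrow> monom_deg m \<le> e"
    by (auto simp: bounded_degree_def)
  then have "\<forall>m. f m + g m \<noteq> 0 \<longrightarrow> monom_deg m \<le> max d e"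
    by (metis add_0 add.right_neutral max.coboundedI1 max.coboundedI2)
  with * show "bounded_degree (\<lambda>m. f m + g m) \<and> symmetric (\<lambda>m. f m + g m)"
    by (auto simp: bounded_degree_def symmetric_def)
qed

lift_definition uminus_symfun :: "symfun \<Rightarrow> symfun" is "\<lambda>f m. - f m"
  by (simp add: bounded_degree_def symmetric_def)

definition minus_symfun :: "symfun \<Rightarrow> symfun \<Rightarrow> symfun" where
  "minus_symfun f g = f + - g"

lift_definition times_symfun :: "symfun \<Rightarrow> symfun \<Rightarrow> symfun" is
  "\<lambda>f g m. \<Sum>(a, b)\<in>{(a, b). a + b = m}. f a * g b"
proof -
  fix f g :: "(nat \<Rightarrow>\<^sub>0 nat) \<Rightarrow> complex"
  assume *: "bounded_degree f \<and> symmetric f" "bounded_degree g \<and> symmetric g"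
  let ?h = "\<lambda>m. \<Sum>(a, b)\<in>{(a, b). a + b = m}. f a * g b"
  obtain d e where de:
    "\<And>m. f m \<noteq> 0 \<Longrightarrow> monom_deg m \<le> d" "\<And>m. g m \<noteq> 0 \<Longrightarrow> monom_deg m \<le> e"
    using * by (auto simp: bounded_degree_def)
  have "monom_deg m \<le> d + e" if "?h m \<noteq> 0" for m
  proof -
    from that obtain x where "x \<in> {(a, b). a + b = m}" "(case x of (a, b) \<Rightarrow> f a * g b) \<noteq> 0"
      by (rule sum.not_neutral_contains_not_neutral)
    then obtain a b where "a + b = m" "f a \<noteq> 0" "g b \<noteq> 0" by auto
    then show ?thesis using de(1)[of a] de(2)[of b] by (auto simp: monom_deg_add)
  qed
  then have "bounded_degree ?h" by (auto simp: bounded_degree_def)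
  moreover have "symmetric ?h"
    unfolding symmetric_def
  proof (intro allI impI)
    fix \<pi> :: "nat \<Rightarrow> nat" and m assume \<pi>: "bij \<pi>"
    then have i: "inj \<pi>" "inj (inv_into UNIV \<pi>)" by (auto simp: bij_is_inj bij_imp_bij_inv)
    show "?h (Poly_Mapping.map_key \<pi> m) = ?h m"
      by (rule sum.reindex_bij_witness
          [where i = "map_prod (Poly_Mapping.map_key \<pi>) (Poly_Mapping.map_key \<pi>)"
            and j = "map_prod (Poly_Mapping.map_key (inv_into UNIV \<pi>)) (Poly_Mapping.map_key (inv_into UNIV \<pi>))"])
        (use * bij_imp_bij_inv[OF \<pi>] in
          \<open>auto simp: map_key_inv[OF \<pi>] map_key_plus[OF i(1)] symmetric_def
            map_key_plus[OF i(2), symmetric]\<close>)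
  qed
  ultimately show "bounded_degree ?h \<and> symmetric ?h" by blast
qed

instance
proof
  fix f g h :: symfun
  show "f * g * h = f * (g * h)"
  proof (transfer, rule ext)
    fix f g h :: "(nat \<Rightarrow>\<^sub>0 nat) \<Rightarrow> complex" and m :: "nat \<Rightarrow>\<^sub>0 nat"
    let ?D = "\<lambda>m :: nat \<Rightarrow>\<^sub>0 nat. {(a, b). a + b = m}"
    have fin: "finite (?D u)" for u by (rule finite_monom_splittings)
    have "(\<Sum>(u, c)\<in>?D m. (\<Sum>(a, b)\<in>?D u. f a * g b) * h c)
        = (\<Sum>x\<in>?D m. \<Sum>y\<in>?D (fst x). f (fst y) * g (snd y) * h (snd x))"
      by (simp add: case_prod_beta sum_distrib_right)
    also have "\<dots> = (\<Sum>(x, y)\<in>Sigma (?D m) (\<lambda>x. ?D (fst x)). f (fst y) * g (snd y) * h (snd x))"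
      by (rule sum.Sigma) (use fin in auto)
    also have "\<dots> = (\<Sum>(x, y)\<in>Sigma (?D m) (\<lambda>x. ?D (snd x)). f (fst x) * (g (fst y) * h (snd y)))"
      by (rule sum.reindex_bij_witness
          [where i = "\<lambda>((a, _), (b, c)). ((a + b, c), (a, b))"
            and j = "\<lambda>((_, c), (a, b)). ((a, b + c), (b, c))"])
        (auto simp: add.assoc mult.assoc)
    also have "\<dots> = (\<Sum>x\<in>?D m. \<Sum>y\<in>?D (snd x). f (fst x) * (g (fst y) * h (snd y)))"
      by (rule sum.Sigma[symmetric]) (use fin in auto)
    also have "\<dots> = (\<Sum>(a, u)\<in>?D m. f a * (\<Sum>(b, c)\<in>?D u. g b * h c))"
      by (simp add: case_prod_beta sum_distrib_left)
    finally show "(\<Sum>(u, c)\<in>?D m. (\<Sum>(a, b)\<in>?D u. f a * g b) * h c)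
        = (\<Sum>(a, u)\<in>?D m. f a * (\<Sum>(b, c)\<in>?D u. g b * h c))" .
  qed
  show "f * g = g * f"
  proof (transfer, rule ext)
    fix f g :: "(nat \<Rightarrow>\<^sub>0 nat) \<Rightarrow> complex" and m
    show "(\<Sum>(a, b)\<in>{(a, b). a + b = m}. f a * g b) = (\<Sum>(a, b)\<in>{(a, b). a + b = m}. g a * f b)"
      by (rule sum.reindex_bij_witness[where i = prod.swap and j = prod.swap])
        (auto simp: add.commute)
  qed
  show "1 * f = f"
  proof (transfer, rule ext)
    fix f :: "(nat \<Rightarrow>\<^sub>0 nat) \<Rightarrow> complex" and m
    have "(\<Sum>(a, b)\<in>{(a, b). a + b = m}. (if a = 0 then 1 else 0) * f b)
        = (\<Sum>(a, b)\<in>{(0 :: nat \<Rightarrow>\<^sub>0 nat, m)}. (if a = 0 then 1 else 0) * f b)"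
      by (rule sum.mono_neutral_right) (auto simp: finite_monom_splittings split: if_splits)
    then show "(\<Sum>(a, b)\<in>{(a, b). a + b = m}. (if a = 0 then 1 else 0) * f b) = f m"
      by simp
  qed
  show "(f + g) * h = f * h + g * h"
    by (transfer, rule ext) (simp add: case_prod_beta distrib_right sum.distrib)
  show "f + g + h = f + (g + h)" by transfer (simp add: add.assoc)
  show "f + g = g + f" by transfer (simp add: add.commute)
  show "0 + f = f" by transfer simp
  show "- f + f = 0" by transfer simp
  show "f - g = f + - g" by (rule minus_symfun_def)
  show "(0 :: symfun) \<noteq> 1" by transfer (metis zero_neq_one)
qed

end

lift_definition sf_const :: "complex \<Rightarrow> symfun" is "\<lambda>c m. if m = 0 then c else 0"
proof -
  fix c :: complex
  have "Poly_Mapping.map_key \<pi> m = 0 \<longleftrightarrow> m = 0" if "bij \<pi>" for \<pi> :: "nat \<Rightarrow> nat" and m :: "nat \<Rightarrow>\<^sub>0 nat"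
    using that map_key_inv(1)[of \<pi> m] by (metis bij_betw_def bij_imp_bij_inv map_key_zero)
  then show "bounded_degree (\<lambda>m. if m = 0 then c else 0)
      \<and> symmetric (\<lambda>m. if m = 0 then c else 0)"
    by (auto simp: bounded_degree_def symmetric_def)
qed

lift_definition sf_e :: "nat \<Rightarrow> symfun" is
  "\<lambda>n m. if monom_deg m = n \<and> (\<forall>i. Poly_Mapping.lookup m i \<le> 1) then 1 else 0"
proof -
  fix n
  have "(\<forall>i. Poly_Mapping.lookup (Poly_Mapping.map_key \<pi> m) i \<le> 1)
      \<longleftrightarrow> (\<forall>i. Poly_Mapping.lookup m i \<le> 1)" if "bij \<pi>" for \<pi> :: "nat \<Rightarrow> nat" and m :: "nat \<Rightarrow>\<^sub>0 nat"
    using that by (metis bij_pointE lookup_map_key_bij)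
  then show "bounded_degree (\<lambda>m. if monom_deg m = n \<and> (\<forall>i. Poly_Mapping.lookup m i \<le> 1) then 1 else 0)
      \<and> symmetric (\<lambda>m. if monom_deg m = n \<and> (\<forall>i. Poly_Mapping.lookup m i \<le> 1) then 1 else 0)"
    by (auto simp: bounded_degree_def symmetric_def monom_deg_map_key)
qed

lift_definition sf_h :: "nat \<Rightarrow> symfun" is "\<lambda>n m. if monom_deg m = n then 1 else 0"
  by (auto simp: bounded_degree_def symmetric_def monom_deg_map_key)

text \<open>Only \<open>n \<ge> 1\<close> is meaningful here.\<close>

lift_definition sf_p :: "nat \<Rightarrow> symfun" is
  "\<lambda>n m. if \<exists>i. m = Poly_Mapping.single i n then 1 else 0"
proof -
  fix n
  have 1: "(\<exists>i. Poly_Mapping.map_key \<pi> m = Poly_Mapping.single i n)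
      \<longleftrightarrow> (\<exists>i. m = Poly_Mapping.single i n)" if \<pi>: "bij \<pi>" for \<pi> :: "nat \<Rightarrow> nat" and m :: "nat \<Rightarrow>\<^sub>0 nat"
  proof -
    have s: "Poly_Mapping.map_key \<rho> (Poly_Mapping.single i n) = Poly_Mapping.single (inv_into UNIV \<rho> i) n"
      if "bij \<rho>" for \<rho> and i :: nat
      using map_key_single[of \<rho> "inv_into UNIV \<rho> i" n] that
      by (simp add: bij_is_inj bij_is_surj surj_f_inv_f)
    show ?thesis using s[OF \<pi>] s[OF bij_imp_bij_inv[OF \<pi>]] map_key_inv(1)[OF \<pi>, of m] by metis
  qed
  have "monom_deg m \<le> n" if "m = Poly_Mapping.single i n" for i m
    using that by (simp add: monom_deg_def)
  then show "bounded_degree (\<lambda>m. if \<exists>i. m = Poly_Mapping.single i n then 1 else 0)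
      \<and> symmetric (\<lambda>m. if \<exists>i. m = Poly_Mapping.single i n then 1 else 0)"
    unfolding bounded_degree_def symmetric_def using 1 by (metis (lifting))
qed

text \<open>The substitution \<open>x\<^sub>i \<mapsto> x\<^sub>i\<^sup>k\<close>, for \<open>k \<ge> 1\<close>.\<close>

lift_definition sf_subst_power :: "nat \<Rightarrow> symfun \<Rightarrow> symfun" is
  "\<lambda>k f m. if \<forall>i. k dvd Poly_Mapping.lookup m i then f (Poly_Mapping.map (\<lambda>e. e div k) m) else 0"
proof -
  fix k :: nat and f :: "(nat \<Rightarrow>\<^sub>0 nat) \<Rightarrow> complex"
  assume *: "bounded_degree f \<and> symmetric f"
  let ?m = "Poly_Mapping.map (\<lambda>e. e div k) :: (nat \<Rightarrow>\<^sub>0 nat) \<Rightarrow> _"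
  let ?F = "\<lambda>m. if \<forall>i. k dvd Poly_Mapping.lookup m i then f (?m m) else 0"
  have lm: "Poly_Mapping.lookup (?m m) i = Poly_Mapping.lookup m i div k" for m i
    by (simp add: map.rep_eq when_def)
  obtain d where d: "\<And>m. f m \<noteq> 0 \<Longrightarrow> monom_deg m \<le> d"
    using * by (auto simp: bounded_degree_def)
  have "monom_deg m \<le> k * d" if "?F m \<noteq> 0" for m
  proof -
    from that have dv: "k dvd Poly_Mapping.lookup m i" for i by (meson)
    from that have "f (?m m) \<noteq> 0" by (simp split: if_splits)
    then have "monom_deg (?m m) \<le> d" by (rule d)
    moreover have "monom_deg (?m m)
        = (\<Sum>i\<in>Poly_Mapping.keys m. Poly_Mapping.lookup (?m m) i)"
      by (rule monom_deg_superset) (auto simp: in_keys_iff lm intro: ccontr)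
    then have "k * monom_deg (?m m) = monom_deg m"
      using dv by (simp add: lm sum_distrib_left monom_deg_def)
    ultimately show ?thesis by (metis mult_le_mono2)
  qed
  then have "bounded_degree ?F" unfolding bounded_degree_def by blast
  moreover have "symmetric ?F"
    unfolding symmetric_def
  proof (intro allI impI)
    fix \<pi> :: "nat \<Rightarrow> nat" and m assume \<pi>: "bij \<pi>"
    have "?m (Poly_Mapping.map_key \<pi> m) = Poly_Mapping.map_key \<pi> (?m m)"
      by (rule poly_mapping_eqI) (simp add: lm lookup_map_key_bij \<pi>)
    moreover have "(\<forall>i. k dvd Poly_Mapping.lookup (Poly_Mapping.map_key \<pi> m) i)
        \<longleftrightarrow> (\<forall>i. k dvd Poly_Mapping.lookup m i)"
      using \<pi> by (metis bij_pointE lookup_map_key_bij)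
    ultimately show "?F (Poly_Mapping.map_key \<pi> m) = ?F m"
      using * \<pi> by (simp add: symmetric_def)
  qed
  ultimately show "bounded_degree ?F \<and> symmetric ?F" by blast
qed

definition sf_alg_hom :: "(symfun \<Rightarrow> symfun) \<Rightarrow> bool" where
  "sf_alg_hom \<phi> \<longleftrightarrow> (\<forall>c. \<phi> (sf_const c) = sf_const c)
     \<and> (\<forall>f g. \<phi> (f + g) = \<phi> f + \<phi> g) \<and> (\<forall>f g. \<phi> (f * g) = \<phi> f * \<phi> g)"

text \<open>
  The algebra of symmetric functions is freely generated by the complete homogeneous functions
  of positive degree, and also by the power sums, so the two algebra endomorphisms below exist
  and are unique. For plethysm, \<open>p\<^sub>k[g] = g(x\<^sub>0\<^sup>k, x\<^sub>1\<^sup>k, \<dots>)\<close>, and \<open>f \<mapsto> f[g]\<close> is an algebra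
  homomorphism; in particular \<open>p\<^sub>k[-g] = -p\<^sub>k[g]\<close>.
\<close>

definition omega :: "symfun \<Rightarrow> symfun" where
  "omega = (THE \<phi>. sf_alg_hom \<phi> \<and> (\<forall>n. \<phi> (sf_h n) = sf_e n))"

definition plethysm :: "symfun \<Rightarrow> symfun \<Rightarrow> symfun" where
  "plethysm f g = (THE \<phi>. sf_alg_hom \<phi> \<and> (\<forall>k\<ge>1. \<phi> (sf_p k) = sf_subst_power k g)) f"

section \<open>Series of symmetric functions\<close>

text \<open>
  A series \<open>Q = q\<^sub>1 + q\<^sub>2 + \<dots>\<close>, with \<open>q\<^sub>i\<close> homogeneous of degree \<open>i\<close>, is given by the sequence of
  its components; the entry at index 0 is never used. Partitions of \<open>n\<close> are multisets of
  positive integers with sum \<open>n\<close>.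
\<close>

definition partitions_of :: "nat \<Rightarrow> nat multiset set" where
  "partitions_of n = {l. 0 \<notin># l \<and> sum_mset l = n}"

definition E_part :: "(nat \<Rightarrow> symfun) \<Rightarrow> nat multiset \<Rightarrow> symfun" where
  "E_part q l = (\<Prod>i\<in>set_mset l. plethysm (sf_e (count l i)) (q i))"

definition E_series :: "(nat \<Rightarrow> symfun) \<Rightarrow> symfun fps" where
  "E_series q = Abs_fps (\<lambda>n. \<Sum>l\<in>partitions_of n. E_part q l)"

definition omega_series :: "symfun fps \<Rightarrow> symfun fps" where
  "omega_series F = Abs_fps (\<lambda>n. omega (fps_nth F n))"

definition omega_alt :: "(nat \<Rightarrow> symfun) \<Rightarrow> nat \<Rightarrow> symfun" where
  "omega_alt q i = (-1) ^ (i - 1) * omega (q i)"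

definition tp :: "nat \<Rightarrow> symfun fps" where
  "tp n = fps_X ^ n * fps_const (sf_p n)"

text \<open>The inverse of a unit of the ring of power series.\<close>

definition unit_inv :: "symfun fps \<Rightarrow> symfun fps" where
  "unit_inv F = (THE G. F * G = 1)"

text \<open>Convergence of the infinite product is with respect to the \<open>t\<close>-adic metric on power series.\<close>

definition prod_over :: "nat set \<Rightarrow> (nat \<Rightarrow> symfun fps) \<Rightarrow> symfun fps" where
  "prod_over A F = prodinf (\<lambda>n. if n \<in> A then F n else 1)"

section \<open>Induced representations and the Frobenius characteristic\<close>

text \<open>
  The representation of \<open>G\<close> induced from a linear character \<open>\<psi>\<close> of \<open>H\<close>, as a matrix
  representation with rows and columns indexed by the left cosets of \<open>H\<close>: in the basis
  \<open>t\<^sub>A \<otimes> 1\<close>, for representatives \<open>t\<^sub>A \<in> A\<close>, the matrix of \<open>g\<close> has the entry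
  \<open>\<psi>(t\<^sub>A\<^sup>-\<^sup>1 g t\<^sub>B)\<close> at \<open>(A, B)\<close>, where \<open>\<psi>\<close> is extended by zero outside \<open>H\<close>.
\<close>

definition coset_rep :: "'a set \<Rightarrow> 'a" where
  "coset_rep A = (SOME t. t \<in> A)"

definition induced_rep ::
    "('a, 'b) monoid_scheme \<Rightarrow> 'a set \<Rightarrow> ('a \<Rightarrow> complex) \<Rightarrow> 'a \<Rightarrow> 'a set \<Rightarrow> 'a set \<Rightarrow> complex" where
  "induced_rep G H \<psi> g A B =
     (let h = inv\<^bsub>G\<^esub> (coset_rep A) \<otimes>\<^bsub>G\<^esub> g \<otimes>\<^bsub>G\<^esub> coset_rep B in if h \<in> H then \<psi> h else 0)"

definition induced_character ::
    "('a, 'b) monoid_scheme \<Rightarrow> 'a set \<Rightarrow> ('a \<Rightarrow> complex) \<Rightarrow> 'a \<Rightarrow> complex" where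
  "induced_character G H \<psi> g = (\<Sum>A\<in>lcosets\<^bsub>G\<^esub> H. induced_rep G H \<psi> g A A)"

text \<open>\<open>w\<close> acts on \<open>{1..n}\<close>, and its orbits there, fixed points included, are its cycles.\<close>

definition p_cycle_type :: "nat \<Rightarrow> (nat \<Rightarrow> nat) \<Rightarrow> symfun" where
  "p_cycle_type n w = (\<Prod>Z\<in>orbit w ` {1..n}. sf_p (card Z))"

definition frobenius_characteristic :: "nat \<Rightarrow> ((nat \<Rightarrow> nat) \<Rightarrow> complex) \<Rightarrow> symfun" where
  "frobenius_characteristic n \<psi> =
     sf_const (1 / fact n) * (\<Sum>w\<in>carrier (sym_group n). sf_const (\<psi> w) * p_cycle_type n w)"

section \<open>The modules \<open>Lie\<^sub>n\<^sup>S\<close>\<close>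

definition P_set :: "nat set \<Rightarrow> nat set" where
  "P_set S = {n. n > 0 \<and> (\<forall>p. prime p \<longrightarrow> p dvd n \<longrightarrow> p \<in> S)}"

definition Q_part :: "nat set \<Rightarrow> nat \<Rightarrow> nat" where
  "Q_part S n = Max {d. d dvd n \<and> d \<in> P_set S}"

definition n_cycle :: "nat \<Rightarrow> (nat \<Rightarrow> nat) \<Rightarrow> bool" where
  "n_cycle n c \<longleftrightarrow> c permutes {1..n} \<and> cyclic_on c {1..n}"

definition cyclic_subgroup :: "nat \<Rightarrow> (nat \<Rightarrow> nat) \<Rightarrow> (nat \<Rightarrow> nat) set" where
  "cyclic_subgroup n c = generate (sym_group n) {c}"

text \<open>The linear character of \<open>\<langle>c\<rangle>\<close> with \<open>c \<mapsto> z\<close>; its values outside \<open>\<langle>c\<rangle>\<close> are irrelevant.\<close>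

definition linear_char :: "nat \<Rightarrow> (nat \<Rightarrow> nat) \<Rightarrow> complex \<Rightarrow> (nat \<Rightarrow> nat) \<Rightarrow> complex" where
  "linear_char n c z = (SOME \<psi>. \<psi> c = z \<and>
     (\<forall>g\<in>cyclic_subgroup n c. \<forall>h\<in>cyclic_subgroup n c. \<psi> (g \<otimes>\<^bsub>sym_group n\<^esub> h) = \<psi> g * \<psi> h))"

text \<open>\<open>c n\<close> is the chosen \<open>n\<close>-cycle, for every \<open>n \<ge> 1\<close>.\<close>

definition Lie_S :: "nat set \<Rightarrow> (nat \<Rightarrow> nat \<Rightarrow> nat) \<Rightarrow> nat \<Rightarrow> symfun" where
  "Lie_S S c n = frobenius_characteristic n
     (induced_character (sym_group n) (cyclic_subgroup n (c n))
       (linear_char n (c n) (exp (2 * of_real pi * \<i> / of_nat n * of_nat (Q_part S n)))))"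

end

theory Submission
  imports Defs
begin

text \<open>
  The products of power sums form a basis of the ring of symmetric functions: the coefficient of
  \<open>p\<^sub>\<lambda>\<close> at a monomial vanishes if the monomial has more variables than \<open>\<lambda>\<close> has parts, and for
  equally many it is nonzero exactly if \<open>\<lambda>\<close> is the type of the monomial. Hence
  homomorphisms may be prescribed on the power sums, and \<open>\<omega>\<close> and plethysm are what they should be.

  Power series with constant term 1 are compared by their logarithmic derivatives
  \<open>t F'(t) / F(t)\<close>. Newton's identities give the one of \<open>E[Q]\<close> as
  \<open>\<Sum>\<^sub>i\<^sub>,\<^sub>k (-1)\<^sup>k\<^sup>-\<^sup>1 i p\<^sub>k[q\<^sub>i] t\<^sup>i\<^sup>k\<close>. For the modules in question,
  \<open>n Lie\<^sub>n = \<Sum>\<^sub>d\<^sub>|\<^sub>n f(d) p\<^sub>d\<^sup>n\<^sup>/\<^sup>d\<close>, where \<open>f(d)\<close> is the sum of the inducing character over the elements of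
  order \<open>d\<close>. Summing \<open>f\<close> over the divisors of \<open>D\<close> sums a character over the subgroup of order \<open>D\<close>,
  which gives \<open>D\<close> or 0, according to whether \<open>D\<close> divides \<open>Q\<^sub>n\<close>, that is, lies in \<open>P(S)\<close>. This holds for
  every \<open>n\<close> divisible by \<open>D\<close>, so \<open>f(d)\<close> does not depend on \<open>n\<close>. It follows that the logarithmic
  derivative of \<open>E[Lie\<^sup>S]\<close> is \<open>\<Sum>\<^sub>D\<^sub>,\<^sub>r D ([D \<in> P(S)] - [D even, D/2 \<in> P(S)]) p\<^sub>D\<^sup>r t\<^sup>D\<^sup>r\<close>, and the
  products have the same one.
\<close>

section \<open>Coefficients of symmetric functions\<close>

lemma sf_eqI: "(\<And>m. sf_coeff f m = sf_coeff g m) \<Longrightarrow> f = g"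
  by (metis ext sf_coeff_inject)

lemma sf_coeff_simps [simp]:
  "sf_coeff 0 m = 0"
  "sf_coeff (f + g) m = sf_coeff f m + sf_coeff g m"
  "sf_coeff (- f) m = - sf_coeff f m"
  "sf_coeff (f - g) m = sf_coeff f m - sf_coeff g m"
  unfolding minus_symfun_def zero_symfun.rep_eq plus_symfun.rep_eq uminus_symfun.rep_eq by simp_all

lemma sf_coeff_sum [simp]: "sf_coeff (sum f A) m = (\<Sum>a\<in>A. sf_coeff (f a) m)"
  by (induction A rule: infinite_finite_induct) auto

lemma sf_coeff_const_mult [simp]: "sf_coeff (sf_const c * f) m = c * sf_coeff f m"
proof -
  have "(\<Sum>(a, b)\<in>{(a, b). a + b = m}. (if a = 0 then c else 0) * sf_coeff f b)
      = (\<Sum>(a, b)\<in>{(0 :: nat \<Rightarrow>\<^sub>0 nat, m)}. (if a = 0 then c else 0) * sf_coeff f b)"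
    by (rule sum.mono_neutral_right) (auto simp: finite_monom_splittings split: if_splits)
  then show ?thesis by (simp add: times_symfun.rep_eq sf_const.rep_eq)
qed

lemma sf_const_0 [simp]: "sf_const 0 = 0"
  and sf_const_1 [simp]: "sf_const 1 = 1"
  and sf_const_add: "sf_const (a + b) = sf_const a + sf_const b"
  and sf_const_minus: "sf_const (- a) = - sf_const a"
  and sf_const_mult: "sf_const (a * b) = sf_const a * sf_const b"
  by (rule sf_eqI, simp add: sf_const.rep_eq one_symfun.rep_eq)+

lemma sf_const_of_nat: "sf_const (of_nat n) = of_nat n"
  by (induction n) (auto simp: sf_const_add)

lemma sf_const_sum: "sf_const (sum f A) = (\<Sum>a\<in>A. sf_const (f a))"
  by (induction A rule: infinite_finite_induct) (auto simp: sf_const_add)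

text \<open>The constant \<open>1 / n\<close> inverts \<open>of_nat n\<close>. This is the division
  by \<open>n\<close> by which a Newton-type recursion determines its \<open>n\<close>th
  term.\<close>

lemma sf_of_nat_mult_cancel:
  assumes "n > 0" "of_nat n * f = of_nat n * (g :: symfun)"
  shows "f = g"
proof -
  have "sf_const (1 / of_nat n) * of_nat n = 1"
    using assms(1) by (simp add: sf_const_of_nat[symmetric] sf_const_mult[symmetric])
  then show ?thesis using assms(2) by (metis mult.assoc mult_1)
qed

section \<open>Multiplication by a power sum\<close>

lemma finite_lookup_ge: "(k :: nat) \<ge> 1 \<Longrightarrow> finite {i. k \<le> Poly_Mapping.lookup m i}"
  by (rule finite_subset[of _ "Poly_Mapping.keys m"]) (auto simp: in_keys_iff)

text \<open>The monomials of \<open>p_k\<close> are the powers \<open>x_i^k\<close>, so a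
  contributing splitting takes such a power off a variable whose exponent is large enough. For
  \<open>k \<ge> 1\<close> different \<open>i\<close> give different monomials, hence no splitting
  is counted twice.\<close>

lemma sf_coeff_p_mult:
  assumes "k \<ge> 1"
  shows "sf_coeff (sf_p k * f) m
    = (\<Sum>i | k \<le> Poly_Mapping.lookup m i. sf_coeff f (m - Poly_Mapping.single i k))"
proof -
  let ?D = "{(a, b). a + b = m}"
  let ?I = "{i. k \<le> Poly_Mapping.lookup m i}"
  let ?s = "\<lambda>i. (Poly_Mapping.single i k, m - Poly_Mapping.single i k)"
  have add: "Poly_Mapping.single i k + (m - Poly_Mapping.single i k) = m" if "i \<in> ?I" for i
    using that by (intro poly_mapping_eqI) (auto simp: lookup_add lookup_minus lookup_single when_def)
  have inj: "inj_on ?s ?I"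
    using assms by (intro inj_onI) (metis Pair_inject lookup_single_eq lookup_single_not_eq not_one_le_zero)
  have "(\<Sum>(a, b)\<in>?D. sf_coeff (sf_p k) a * sf_coeff f b)
      = (\<Sum>(a, b)\<in>?s ` ?I. sf_coeff (sf_p k) a * sf_coeff f b)"
  proof (rule sum.mono_neutral_right)
    show "finite ?D" by (rule finite_monom_splittings)
    show "?s ` ?I \<subseteq> ?D" using add by auto
    show "\<forall>x\<in>?D - ?s ` ?I. (case x of (a, b) \<Rightarrow> sf_coeff (sf_p k) a * sf_coeff f b) = 0"
    proof
      fix x assume x: "x \<in> ?D - ?s ` ?I"
      then obtain a b where ab: "x = (a, b)" "m = a + b" by auto
      have "a \<noteq> Poly_Mapping.single i k" for i
        using x by (force simp: ab lookup_add image_iff)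
      then show "(case x of (a, b) \<Rightarrow> sf_coeff (sf_p k) a * sf_coeff f b) = 0"
        by (auto simp: ab sf_p.rep_eq)
    qed
  qed
  also have "\<dots> = (\<Sum>i\<in>?I. sf_coeff f (m - Poly_Mapping.single i k))"
    by (subst sum.reindex[OF inj]) (auto simp: sf_p.rep_eq intro!: sum.cong)
  finally show ?thesis by (simp add: times_symfun.rep_eq)
qed

lemma monom_deg_minus_single:
  assumes "k \<le> Poly_Mapping.lookup m i"
  shows "monom_deg (m - Poly_Mapping.single i k) = monom_deg m - k" "k \<le> monom_deg m"
proof -
  have "m = (m - Poly_Mapping.single i k) + Poly_Mapping.single i k"
    using assms by (intro poly_mapping_eqI) (auto simp: lookup_add lookup_minus lookup_single when_def)
  then have "monom_deg m = monom_deg (m - Poly_Mapping.single i k) + monom_deg (Poly_Mapping.single i k)"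
    by (metis monom_deg_add)
  moreover have "monom_deg (Poly_Mapping.single i k) = k"
    by (simp add: monom_deg_def)
  ultimately show "monom_deg (m - Poly_Mapping.single i k) = monom_deg m - k" "k \<le> monom_deg m"
    by simp_all
qed

lemma monom_deg_minus_single_eq_iff:
  assumes "k \<le> Poly_Mapping.lookup m i" "k \<le> n"
  shows "monom_deg (m - Poly_Mapping.single i k) = n - k \<longleftrightarrow> monom_deg m = n"
  using monom_deg_minus_single[OF assms(1)] assms(2) by auto

lemma sf_h_0 [simp]: "sf_h 0 = 1" and sf_e_0 [simp]: "sf_e 0 = 1"
proof -
  have z: "monom_deg m = 0 \<longleftrightarrow> m = 0" for m
    by (auto simp: monom_deg_def in_keys_iff intro!: poly_mapping_eqI)
  show "sf_h 0 = 1" by (rule sf_eqI) (simp add: sf_h.rep_eq one_symfun.rep_eq z)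
  show "sf_e 0 = 1" by (rule sf_eqI) (auto simp: sf_e.rep_eq one_symfun.rep_eq z)
qed

section \<open>Newton's identities\<close>

lemma sf_coeff_sum_p_mult:
  "sf_coeff (\<Sum>k=1..n. F k * (sf_p k * G k)) m
    = (\<Sum>k=1..n. \<Sum>i | k \<le> Poly_Mapping.lookup m i. sf_coeff (F k * G k) (m - Poly_Mapping.single i k))"
  unfolding sf_coeff_sum
  by (rule sum.cong) (simp_all add: mult.left_commute[of "F _" "sf_p _"] sf_coeff_p_mult)

text \<open>Double counting of the pairs \<open>(k, i)\<close> where \<open>k\<close> is positive
  and at most the exponent of \<open>x_i\<close>. The range of \<open>k\<close> on the left loses
  none of them because no exponent exceeds the degree.\<close>

lemma sum_swap_lookup:
  "(\<Sum>k=1..monom_deg m. \<Sum>i | k \<le> Poly_Mapping.lookup m i. F k i)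
    = (\<Sum>i\<in>Poly_Mapping.keys m. \<Sum>k=1..Poly_Mapping.lookup m i. F k i)"
proof -
  have *: "{i \<in> Poly_Mapping.keys m. k \<le> Poly_Mapping.lookup m i} = {i. k \<le> Poly_Mapping.lookup m i}"
    if "k \<ge> 1" for k using that by (auto simp: in_keys_iff)
  have **: "{k \<in> {1..monom_deg m}. k \<le> Poly_Mapping.lookup m i} = {1..Poly_Mapping.lookup m i}" for i
    using monom_deg_minus_single(2)[of "Poly_Mapping.lookup m i" m i] by auto
  show ?thesis
    using sum.swap_restrict[of "{1..monom_deg m}" "Poly_Mapping.keys m" F
        "\<lambda>k i. k \<le> Poly_Mapping.lookup m i"]
    by (simp only: ** finite_atLeastAtMost finite_keys simp_thms) (simp add: * cong: sum.cong_simp del: One_nat_def)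
qed

text \<open>At a monomial of degree \<open>n\<close>, every pair of a variable and a positive number
  up to its exponent contributes 1 to the right side, and there are \<open>n\<close> such
  pairs.\<close>

lemma sf_h_newton: "of_nat n * sf_h n = (\<Sum>k=1..n. sf_p k * sf_h (n - k))"
proof (rule sf_eqI)
  fix m
  have 1: "sf_coeff (of_nat n * sf_h n) m = of_nat n * (if monom_deg m = n then 1 else 0)"
    by (simp add: sf_const_of_nat[symmetric] sf_h.rep_eq)
  have 2: "sf_coeff (\<Sum>k=1..n. sf_p k * sf_h (n - k)) m
      = (\<Sum>k=1..n. \<Sum>i | k \<le> Poly_Mapping.lookup m i. if monom_deg m = n then 1 else 0)"
    using sf_coeff_sum_p_mult[of "\<lambda>_. 1" "\<lambda>k. sf_h (n - k)" n m]
    by (simp add: sf_h.rep_eq monom_deg_minus_single_eq_iff)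
  show "sf_coeff (of_nat n * sf_h n) m = sf_coeff (\<Sum>k=1..n. sf_p k * sf_h (n - k)) m"
  proof (cases "monom_deg m = n")
    case True
    have "(\<Sum>k=1..monom_deg m. \<Sum>i | k \<le> Poly_Mapping.lookup m i. 1 :: complex) = of_nat (monom_deg m)"
      unfolding sum_swap_lookup by (simp add: monom_deg_def)
    then show ?thesis unfolding 1 2 using True by simp
  qed (simp only: 1 2, simp)
qed

text \<open>The pairs are grouped by variable. If all other exponents are at most 1, a variable of
  exponent 1 contributes 1, and one of larger exponent leaves two terms of opposite sign. The total
  is the degree for a squarefree monomial and 0 otherwise.\<close>

lemma sf_e_newton: "of_nat n * sf_e n = (\<Sum>k=1..n. (-1) ^ (k - 1) * (sf_p k * sf_e (n - k)))"
proof (rule sf_eqI)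
  fix m :: "nat \<Rightarrow>\<^sub>0 nat"
  let ?l = "Poly_Mapping.lookup m"
  define sq where "sq m \<longleftrightarrow> (\<forall>i. Poly_Mapping.lookup m i \<le> (1 :: nat))" for m :: "nat \<Rightarrow>\<^sub>0 nat"
  have c: "((-1) ^ j :: symfun) = sf_const ((-1) ^ j)" for j
    by (induction j) (auto simp: sf_const_mult sf_const_minus)
  have 1: "sf_coeff (of_nat n * sf_e n) m = of_nat n * (if monom_deg m = n \<and> sq m then 1 else 0)"
    by (simp add: sf_const_of_nat[symmetric] sf_e.rep_eq sq_def)
  have 2: "sf_coeff (\<Sum>k=1..n. (-1) ^ (k - 1) * (sf_p k * sf_e (n - k))) m
      = (\<Sum>k=1..n. \<Sum>i | k \<le> ?l i.
           if monom_deg m = n \<and> sq (m - Poly_Mapping.single i k) then (-1) ^ (k - 1) else 0)"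
    unfolding sf_coeff_sum_p_mult
    by (intro sum.cong refl) (auto simp: c sf_e.rep_eq sq_def monom_deg_minus_single_eq_iff)
  have 3: "(\<Sum>k=1..?l i. if sq (m - Poly_Mapping.single i k) then (-1) ^ (k - 1) else (0 :: complex))
      = (if sq m then 1 else 0)" if i: "i \<in> Poly_Mapping.keys m" for i
  proof (cases "\<forall>j. j \<noteq> i \<longrightarrow> ?l j \<le> 1")
    case False
    then have "\<not> sq m" "\<not> sq (m - Poly_Mapping.single i k)" for k
      by (auto simp: sq_def lookup_minus lookup_single when_def)
    then show ?thesis by simp
  next
    case True
    then have s: "sq m \<longleftrightarrow> ?l i \<le> 1" "sq (m - Poly_Mapping.single i k) \<longleftrightarrow> ?l i - k \<le> 1" for k
      by (auto simp: sq_def lookup_minus lookup_single when_def)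
    show ?thesis
    proof (cases "?l i = 1")
      case True
      then show ?thesis by (simp add: s)
    next
      case False
      with i obtain a where a: "?l i = Suc (Suc a)"
        by (metis One_nat_def in_keys_iff not0_implies_Suc)
      \<comment> \<open>Removing \<open>x_i^k\<close> leaves an exponent of at most 1 only for the
        two largest \<open>k\<close>, and their signs cancel.\<close>
      have "(\<Sum>k=1..?l i. if sq (m - Poly_Mapping.single i k) then (-1) ^ (k - 1) else (0 :: complex))
          = (\<Sum>k\<in>{Suc a, Suc (Suc a)}. (-1) ^ (k - 1))"
        by (rule sum.mono_neutral_cong_right) (auto simp: s a)
      then show ?thesis by (simp add: s a)
    qed
  qed
  show "sf_coeff (of_nat n * sf_e n) m
      = sf_coeff (\<Sum>k=1..n. (-1) ^ (k - 1) * (sf_p k * sf_e (n - k))) m"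
  proof (cases "monom_deg m = n")
    case True
    have "(\<Sum>k=1..monom_deg m. \<Sum>i | k \<le> ?l i.
        if sq (m - Poly_Mapping.single i k) then (-1) ^ (k - 1) else (0 :: complex))
      = of_nat (monom_deg m) * (if sq m then 1 else 0)"
    proof -
      have "Poly_Mapping.lookup m i = 1" if "sq m" "i \<in> Poly_Mapping.keys m" for i
        using that by (metis One_nat_def in_keys_iff le_Suc_eq le_zero_eq sq_def)
      then have "(\<Sum>i\<in>Poly_Mapping.keys m. if sq m then 1 else 0)
          = complex_of_nat (monom_deg m) * (if sq m then 1 else 0)"
        by (simp add: monom_deg_def)
      then show ?thesis unfolding sum_swap_lookup using 3 by (simp del: One_nat_def)
    qed
    then show ?thesis unfolding 1 2 using True by simp
  qed (simp only: 1 2, simp)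
qed

section \<open>Power substitution\<close>

lemma lookup_map_div: "Poly_Mapping.lookup (Poly_Mapping.map (\<lambda>e. e div k) m) i = Poly_Mapping.lookup m i div k"
  for k :: nat
  by (simp add: map.rep_eq when_def)

text \<open>For products, a splitting of \<open>m\<close> contributes only if both factors have all
  exponents divisible by \<open>k\<close>, and dividing by \<open>k\<close> matches these splittings
  with those of the reduced monomial.\<close>

lemma sf_alg_hom_subst_power:
  assumes "k \<ge> 1"
  shows "sf_alg_hom (sf_subst_power k)"
proof -
  let ?m = "Poly_Mapping.map (\<lambda>e. e div k) :: (nat \<Rightarrow>\<^sub>0 nat) \<Rightarrow> _"
  let ?M = "Poly_Mapping.map (\<lambda>e. k * e) :: (nat \<Rightarrow>\<^sub>0 nat) \<Rightarrow> _"
  have M: "Poly_Mapping.lookup (?M m) i = k * Poly_Mapping.lookup m i" for m i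
    by (simp add: map.rep_eq when_def)
  have "sf_subst_power k (sf_const c) = sf_const c" for c
  proof (rule sf_eqI)
    fix m :: "nat \<Rightarrow>\<^sub>0 nat"
    have "m = 0" if "?m m = 0" "\<forall>i. k dvd Poly_Mapping.lookup m i"
    proof (rule poly_mapping_eqI)
      fix i
      have "Poly_Mapping.lookup m i div k = 0" using that(1) by (metis lookup_map_div lookup_zero)
      then show "Poly_Mapping.lookup m i = Poly_Mapping.lookup 0 i"
        using that(2) by (metis dvd_mult_div_cancel lookup_zero mult_0_right)
    qed
    then show "sf_coeff (sf_subst_power k (sf_const c)) m = sf_coeff (sf_const c) m"
      by (auto simp: sf_subst_power.rep_eq sf_const.rep_eq)
         (metis lookup_map_div div_0 lookup_zero poly_mapping_eqI)
  qed
  moreover have "sf_subst_power k (f + g) = sf_subst_power k f + sf_subst_power k g" for f g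
    by (rule sf_eqI) (simp add: sf_subst_power.rep_eq)
  moreover have "sf_subst_power k (f * g) = sf_subst_power k f * sf_subst_power k g" for f g
  proof (rule sf_eqI)
    fix m :: "nat \<Rightarrow>\<^sub>0 nat"
    let ?F = "\<lambda>(a, b). sf_coeff (sf_subst_power k f) a * sf_coeff (sf_subst_power k g) b"
    show "sf_coeff (sf_subst_power k (f * g)) m = sf_coeff (sf_subst_power k f * sf_subst_power k g) m"
    proof (cases "\<forall>i. k dvd Poly_Mapping.lookup m i")
      case False
      have "?F x = 0" if "x \<in> {(a, b). a + b = m}" for x
        using that False by (auto simp: sf_subst_power.rep_eq lookup_add)
      then have "sum ?F {(a, b). a + b = m} = 0" by (rule sum.neutral[rule_format])
      then show ?thesis using False by (auto simp: sf_subst_power.rep_eq times_symfun.rep_eq)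
    next
      case True
      let ?T = "{(a, b). a + b = m \<and> (\<forall>i. k dvd Poly_Mapping.lookup a i) \<and> (\<forall>i. k dvd Poly_Mapping.lookup b i)}"
      have key: "Poly_Mapping.lookup a i + Poly_Mapping.lookup b i = Poly_Mapping.lookup m i div k"
        if "a + b = ?m m" for a b i
        using that by (metis lookup_add lookup_map_div)
      have "sum ?F {(a, b). a + b = m} = sum ?F ?T"
        by (rule sum.mono_neutral_right) (auto simp: finite_monom_splittings sf_subst_power.rep_eq split: if_splits)
      also have "sum ?F ?T = (\<Sum>(a, b)\<in>{(a, b). a + b = ?m m}. sf_coeff f a * sf_coeff g b)"
        by (rule sum.reindex_bij_witness[where i = "map_prod ?M ?M" and j = "map_prod ?m ?m"])
          (use True assms in \<open>auto intro!: poly_mapping_eqI simp: M lookup_map_div lookup_add key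
             sf_subst_power.rep_eq div_plus_div_distrib_dvd_left simp flip: distrib_left\<close>)
      finally show ?thesis using True by (simp add: sf_subst_power.rep_eq times_symfun.rep_eq)
    qed
  qed
  ultimately show ?thesis by (simp add: sf_alg_hom_def)
qed

lemma sf_subst_power_p:
  assumes "k \<ge> 1"
  shows "sf_subst_power k (sf_p n) = sf_p (k * n)"
proof (rule sf_eqI)
  fix m :: "nat \<Rightarrow>\<^sub>0 nat"
  have "(\<forall>i. k dvd Poly_Mapping.lookup m i) \<and> Poly_Mapping.map (\<lambda>e. e div k) m = Poly_Mapping.single j n
      \<longleftrightarrow> m = Poly_Mapping.single j (k * n)" for j
  proof
    assume *: "(\<forall>i. k dvd Poly_Mapping.lookup m i) \<and> Poly_Mapping.map (\<lambda>e. e div k) m = Poly_Mapping.single j n"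
    show "m = Poly_Mapping.single j (k * n)"
    proof (rule poly_mapping_eqI)
      fix i
      have "Poly_Mapping.lookup m i = k * (Poly_Mapping.lookup m i div k)" using * by simp
      also have "Poly_Mapping.lookup m i div k = Poly_Mapping.lookup (Poly_Mapping.single j n) i"
        using * by (metis lookup_map_div)
      finally show "Poly_Mapping.lookup m i = Poly_Mapping.lookup (Poly_Mapping.single j (k * n)) i"
        by (simp add: lookup_single when_def)
    qed
  next
    assume "m = Poly_Mapping.single j (k * n)"
    then show "(\<forall>i. k dvd Poly_Mapping.lookup m i) \<and> Poly_Mapping.map (\<lambda>e. e div k) m = Poly_Mapping.single j n"
      using assms by (auto intro!: poly_mapping_eqI simp: lookup_map_div lookup_single when_def)
  qed
  then show "sf_coeff (sf_subst_power k (sf_p n)) m = sf_coeff (sf_p (k * n)) m"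
    by (auto simp: sf_subst_power.rep_eq sf_p.rep_eq)
qed

section \<open>Products of power sums form a basis\<close>

text \<open>
  Entry \<open>i\<close> of a multiset stands for the power sum of degree \<open>i + 1\<close>, so that no positivity
  side condition is needed and a polynomial in the power sums is an element of
  \<open>nat multiset \<Rightarrow>\<^sub>0 complex\<close>.
\<close>

definition mon_type :: "(nat \<Rightarrow>\<^sub>0 nat) \<Rightarrow> nat multiset" where
  "mon_type m = image_mset (\<lambda>i. Poly_Mapping.lookup m i - 1) (mset_set (Poly_Mapping.keys m))"

definition p_prod :: "nat multiset \<Rightarrow> symfun" where
  "p_prod l = prod_mset (image_mset (\<lambda>i. sf_p (Suc i)) l)"

lemma p_prod_empty: "p_prod {#} = 1"
  and p_prod_add: "p_prod (add_mset i l) = sf_p (Suc i) * p_prod l"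
  by (simp_all add: p_prod_def)

lemma size_mon_type [simp]: "size (mon_type m) = card (Poly_Mapping.keys m)"
  by (simp add: mon_type_def)

lemma keys_minus_single:
  fixes m :: "nat \<Rightarrow>\<^sub>0 nat"
  assumes "k \<le> Poly_Mapping.lookup m j" "k \<ge> 1"
  shows "Poly_Mapping.keys m = insert j (Poly_Mapping.keys (m - Poly_Mapping.single j k))"
  using assms by (auto simp: in_keys_iff lookup_minus lookup_single when_def split: if_splits)

lemma mon_type_minus_single:
  fixes m :: "nat \<Rightarrow>\<^sub>0 nat"
  assumes "Poly_Mapping.lookup m j = Suc i"
  shows "mon_type m = add_mset i (mon_type (m - Poly_Mapping.single j (Suc i)))"
proof -
  let ?m = "m - Poly_Mapping.single j (Suc i)"
  have k: "Poly_Mapping.keys m = insert j (Poly_Mapping.keys ?m)"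
    using assms by (intro keys_minus_single) auto
  have j: "j \<notin> Poly_Mapping.keys ?m"
    using assms by (simp add: in_keys_iff lookup_minus)
  have "image_mset (\<lambda>i. Poly_Mapping.lookup m i - 1) (mset_set (Poly_Mapping.keys ?m)) = mon_type ?m"
    unfolding mon_type_def
    by (rule image_mset_cong) (use j in \<open>auto simp: lookup_minus lookup_single when_def\<close>)
  then show ?thesis
    using assms j by (simp add: mon_type_def k)
qed

text \<open>Natural coefficients cannot cancel; \<open>p_prod_diag\<close> relies on this to see
  that a diagonal coefficient is nonzero.\<close>

lemma p_prod_coeff_Nats: "sf_coeff (p_prod l) m \<in> \<nat>"
proof (induction l arbitrary: m)
  case empty
  then show ?case by (simp add: p_prod_empty one_symfun.rep_eq)
next
  case (add i l)
  have "(\<Sum>j\<in>A. sf_coeff (p_prod l) (M j)) \<in> \<nat>" for A :: "nat set" and M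
    by (induction A rule: infinite_finite_induct) (auto intro: add.IH Nats_add)
  then show ?case by (simp add: p_prod_add sf_coeff_p_mult)
qed

text \<open>A monomial of \<open>p_prod l\<close> arises by choosing a variable for every part.
  Choosing a variable twice adds exponents and lowers the number of variables, so only distinct
  choices attain \<open>size l\<close> variables, and then the exponents are the parts.\<close>

lemma p_prod_nonzero:
  assumes "sf_coeff (p_prod l) m \<noteq> 0"
  shows "card (Poly_Mapping.keys m) \<le> size l"
    and "card (Poly_Mapping.keys m) = size l \<Longrightarrow> mon_type m = l"
proof -
  have "card (Poly_Mapping.keys m) \<le> size l \<and> (card (Poly_Mapping.keys m) = size l \<longrightarrow> mon_type m = l)"
    using assms
  proof (induction l arbitrary: m)
    case empty
    then show ?case by (simp add: p_prod_empty one_symfun.rep_eq mon_type_def split: if_splits)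
  next
    case (add i l)
    let ?m = "\<lambda>j. m - Poly_Mapping.single j (Suc i)"
    from add.prems obtain j where j: "Suc i \<le> Poly_Mapping.lookup m j" "sf_coeff (p_prod l) (?m j) \<noteq> 0"
      by (auto simp: p_prod_add sf_coeff_p_mult elim!: sum.not_neutral_contains_not_neutral)
    note IH = add.IH[OF j(2)]
    have k: "Poly_Mapping.keys m = insert j (Poly_Mapping.keys (?m j))"
      using j by (intro keys_minus_single) auto
    then have le: "card (Poly_Mapping.keys m) \<le> Suc (card (Poly_Mapping.keys (?m j)))"
      by (simp add: card_insert_if)
    moreover have "mon_type m = add_mset i l" if eq: "card (Poly_Mapping.keys m) = Suc (size l)"
    proof -
      have *: "card (Poly_Mapping.keys (?m j)) = size l" "j \<notin> Poly_Mapping.keys (?m j)"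
        using IH le eq k by (auto simp: insert_absorb card_insert_if split: if_splits)
      then have "Poly_Mapping.lookup m j = Suc i"
        using j(1) by (simp add: in_keys_iff lookup_minus)
      then show ?thesis using mon_type_minus_single IH * by metis
    qed
    ultimately show ?case using IH by auto
  qed
  then show "card (Poly_Mapping.keys m) \<le> size l"
    "card (Poly_Mapping.keys m) = size l \<Longrightarrow> mon_type m = l" by auto
qed

text \<open>Assigning every part to a variable with that exponent yields \<open>m\<close>, and the
  other contributions are nonnegative.\<close>

lemma p_prod_diag:
  assumes "mon_type m = l"
  shows "sf_coeff (p_prod l) m \<noteq> 0"
  using assms
proof (induction l arbitrary: m)
  case empty
  then have "Poly_Mapping.keys m = {}" by (simp add: mon_type_def mset_set_empty_iff)
  then have "m = 0" by simp
  then show ?case by (simp add: p_prod_empty one_symfun.rep_eq)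
next
  case (add i l)
  let ?m = "\<lambda>j. m - Poly_Mapping.single j (Suc i)"
  have "i \<in># mon_type m" using add.prems by simp
  then obtain j where j: "j \<in> Poly_Mapping.keys m" "i = Poly_Mapping.lookup m j - 1"
    by (auto simp: mon_type_def)
  then have lj: "Poly_Mapping.lookup m j = Suc i" by (simp add: in_keys_iff)
  then have "mon_type (?m j) = l" using mon_type_minus_single[OF lj] add.prems by simp
  then have nz: "sf_coeff (p_prod l) (?m j) \<noteq> 0" by (rule add.IH)
  have "\<forall>j. \<exists>n. sf_coeff (p_prod l) (?m j) = of_nat n"
    using p_prod_coeff_Nats Nats_cases by blast
  from choice[OF this] obtain F where F: "\<And>j. sf_coeff (p_prod l) (?m j) = of_nat (F j)"
    by blast
  have "sf_coeff (p_prod (add_mset i l)) m = of_nat (\<Sum>j | Suc i \<le> Poly_Mapping.lookup m j. F j)"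
    by (simp add: p_prod_add sf_coeff_p_mult F)
  moreover have "(\<Sum>j | Suc i \<le> Poly_Mapping.lookup m j. F j) \<noteq> 0"
    using lj nz finite_lookup_ge[of "Suc i" m] by (auto simp: F intro!: exI[of _ j])
  ultimately show ?case by (simp del: of_nat_sum)
qed

text \<open>Monomials of equal type differ by a permutation of the variables, under which
  \<open>f\<close> is invariant.\<close>

lemma sf_coeff_cong_mon_type:
  assumes "mon_type m = mon_type m'"
  shows "sf_coeff f m = sf_coeff f m'"
proof -
  let ?A = "Poly_Mapping.keys m \<union> Poly_Mapping.keys m'"
  \<comment> \<open>Both monomials are read on the union of their variable sets, padded with zero
    exponents, so that a permutation of this finite set can carry one to the other.\<close>
  have *: "image_mset (Poly_Mapping.lookup u) (mset_set ?A)
      = image_mset Suc (mon_type u) + replicate_mset (card ?A - card (Poly_Mapping.keys u)) 0"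
    if "Poly_Mapping.keys u \<subseteq> ?A" for u :: "nat \<Rightarrow>\<^sub>0 nat"
  proof -
    have "mset_set ?A = mset_set (Poly_Mapping.keys u) + mset_set (?A - Poly_Mapping.keys u)"
      using that by (subst mset_set_Union[symmetric]) (auto intro!: arg_cong[of _ _ mset_set])
    moreover have "image_mset (Poly_Mapping.lookup u) (mset_set (Poly_Mapping.keys u)) = image_mset Suc (mon_type u)"
      unfolding mon_type_def image_mset.compositionality
      by (rule image_mset_cong) (auto simp: in_keys_iff)
    moreover have "image_mset (Poly_Mapping.lookup u) (mset_set (?A - Poly_Mapping.keys u))
        = image_mset (\<lambda>_. 0) (mset_set (?A - Poly_Mapping.keys u))"
      by (rule image_mset_cong) (auto simp: in_keys_iff)
    ultimately show ?thesis
      using that by (simp add: image_mset_const_eq card_Diff_subset)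
  qed
  have "card (Poly_Mapping.keys m) = card (Poly_Mapping.keys m')"
    using assms by (metis size_mon_type)
  then have "image_mset (Poly_Mapping.lookup m) (mset_set ?A) = image_mset (Poly_Mapping.lookup m') (mset_set ?A)"
    using *[of m] *[of m'] assms by simp
  then obtain \<pi> where \<pi>: "\<pi> permutes ?A" "\<forall>x\<in>?A. Poly_Mapping.lookup m x = Poly_Mapping.lookup m' (\<pi> x)"
    using image_mset_eq_implies_permutes[of ?A] by (metis finite_Un finite_keys)
  have bij: "bij \<pi>" using \<pi>(1) by (rule permutes_bij)
  have "Poly_Mapping.map_key \<pi> m' = m"
  proof (rule poly_mapping_eqI)
    fix x
    show "Poly_Mapping.lookup (Poly_Mapping.map_key \<pi> m') x = Poly_Mapping.lookup m x"
    proof (cases "x \<in> ?A")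
      case False
      then have "\<pi> x = x" using \<pi>(1) by (metis permutes_def)
      then show ?thesis using False bij by (auto simp: lookup_map_key_bij in_keys_iff)
    qed (use \<pi> bij in \<open>simp add: lookup_map_key_bij\<close>)
  qed
  moreover have "symmetric (sf_coeff f)" using sf_coeff[of f] by simp
  ultimately show ?thesis using bij by (metis symmetric_def)
qed

section \<open>Algebra homomorphisms\<close>

text \<open>For \<open>P = p_prod\<close> this evaluates a formal polynomial at the power sums.
  Other multiplicative \<open>P\<close> prescribe other values for them, which is how homomorphisms
  are built.\<close>

definition poly_eval :: "(nat multiset \<Rightarrow> symfun) \<Rightarrow> (nat multiset \<Rightarrow>\<^sub>0 complex) \<Rightarrow> symfun" where
  "poly_eval P r = (\<Sum>l\<in>Poly_Mapping.keys r. sf_const (Poly_Mapping.lookup r l) * P l)"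

lemma poly_eval_superset:
  assumes "finite A" "Poly_Mapping.keys r \<subseteq> A"
  shows "poly_eval P r = (\<Sum>l\<in>A. sf_const (Poly_Mapping.lookup r l) * P l)"
  unfolding poly_eval_def
  by (rule sum.mono_neutral_left) (use assms in \<open>auto simp: in_keys_iff\<close>)

lemma poly_eval_0 [simp]: "poly_eval P 0 = 0"
  by (simp add: poly_eval_def)

lemma poly_eval_single [simp]: "poly_eval P (Poly_Mapping.single l c) = sf_const c * P l"
  by (simp add: poly_eval_def)

lemma poly_eval_add: "poly_eval P (r + s) = poly_eval P r + poly_eval P s"
proof -
  let ?A = "Poly_Mapping.keys r \<union> Poly_Mapping.keys s"
  have "Poly_Mapping.keys (r + s) \<subseteq> ?A" by (rule keys_add)
  then show ?thesis
    by (simp add: poly_eval_superset[of ?A] lookup_add sf_const_add algebra_simps sum.distrib)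
qed

lemma poly_eval_uminus: "poly_eval P (- r) = - poly_eval P r"
  using poly_eval_add[of P r "- r"] by (simp add: add_eq_0_iff)

lemma poly_eval_sum: "poly_eval P (sum r A) = (\<Sum>a\<in>A. poly_eval P (r a))"
  by (induction A rule: infinite_finite_induct) (auto simp: poly_eval_add)

lemma poly_mapping_eq_sum_single:
  "(r :: nat multiset \<Rightarrow>\<^sub>0 complex)
    = (\<Sum>l\<in>Poly_Mapping.keys r. Poly_Mapping.single l (Poly_Mapping.lookup r l))"
  by (rule poly_mapping_eqI)
     (auto simp: lookup_sum lookup_single when_def in_keys_iff)

text \<open>Addition of multisets multiplies monomials, so the convolution product on
  \<open>nat multiset \<Rightarrow>\<^sub>0 complex\<close> is multiplication of
  polynomials.\<close>

lemma poly_eval_mult: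
  assumes "\<And>k l. P (k + l) = P k * P l"
  shows "poly_eval P (r * s) = poly_eval P r * poly_eval P s"
proof -
  have "r * s = (\<Sum>k\<in>Poly_Mapping.keys r. \<Sum>l\<in>Poly_Mapping.keys s.
      Poly_Mapping.single (k + l) (Poly_Mapping.lookup r k * Poly_Mapping.lookup s l))"
    by (subst (1) poly_mapping_eq_sum_single[of r], subst (1) poly_mapping_eq_sum_single[of s])
       (simp add: sum_product mult_single)
  then have "poly_eval P (r * s) = (\<Sum>k\<in>Poly_Mapping.keys r. \<Sum>l\<in>Poly_Mapping.keys s.
      sf_const (Poly_Mapping.lookup r k * Poly_Mapping.lookup s l) * P (k + l))"
    by (simp only: poly_eval_sum poly_eval_single)
  also have "\<dots> = poly_eval P r * poly_eval P s"
    by (simp add: poly_eval_def sum_product sf_const_mult assms mult_ac)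
  finally show ?thesis .
qed

section \<open>The power sums as free generators\<close>

text \<open>At a monomial whose type \<open>l\<close> is a key of maximal size, the products
  belonging to all other keys have coefficient 0, while \<open>p_prod l\<close> does not. So no
  nontrivial combination vanishes.\<close>

lemma inj_poly_eval_p_prod: "inj (poly_eval p_prod)"
proof (rule injI)
  fix r s :: "nat multiset \<Rightarrow>\<^sub>0 complex"
  assume eq: "poly_eval p_prod r = poly_eval p_prod s"
  define u where "u = r - s"
  have u0: "poly_eval p_prod u = 0"
    using eq poly_eval_add[of p_prod r "- s"] by (simp add: u_def poly_eval_uminus)
  have "u = 0"
  proof (rule ccontr)
    assume "u \<noteq> 0"
    then have "Max (size ` Poly_Mapping.keys u) \<in> size ` Poly_Mapping.keys u"
      by (intro Max_in) auto
    then obtain l where l: "l \<in> Poly_Mapping.keys u" "Max (size ` Poly_Mapping.keys u) = size l"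
      by (rule imageE)
    \<comment> \<open>A monomial of prescribed type is built by giving each part a fresh
      variable.\<close>
    have "\<exists>m. mon_type m = l"
    proof (induction l)
      case empty
      have "mon_type 0 = {#}" by (simp add: mon_type_def)
      then show ?case ..
    next
      case (add i l)
      then obtain m where m: "mon_type m = l" by blast
      obtain j where j: "j \<notin> Poly_Mapping.keys m"
        using ex_new_if_finite[of "Poly_Mapping.keys m"] by auto
      let ?m = "m + Poly_Mapping.single j (Suc i)"
      have "Poly_Mapping.lookup ?m j = Suc i" using j by (simp add: lookup_add in_keys_iff)
      then have "mon_type ?m = add_mset i (mon_type m)"
        using mon_type_minus_single[of ?m j i] by simp
      then show ?case using m by blast
    qed
    then obtain m where m: "mon_type m = l" by blast
    have "sf_coeff (p_prod k) m = 0" if "k \<in> Poly_Mapping.keys u - {l}" for k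
    proof (rule ccontr)
      assume nz: "sf_coeff (p_prod k) m \<noteq> 0"
      have "size k \<le> size l" unfolding l(2)[symmetric] using that by (intro Max_ge) auto
      moreover have "card (Poly_Mapping.keys m) = size l" using m by auto
      ultimately have "mon_type m = k" using p_prod_nonzero[OF nz] by auto
      then show False using that m by simp
    qed
    then have "sf_coeff (poly_eval p_prod u) m = Poly_Mapping.lookup u l * sf_coeff (p_prod l) m"
      unfolding poly_eval_def sum.remove[OF finite_keys l(1)] by simp
    then show False using u0 l(1) p_prod_diag[OF m] by (simp add: in_keys_iff)
  qed
  then show "r = s" unfolding u_def by (rule eq_iff_diff_eq_0[THEN iffD2])
qed

lemma finite_mon_types: "finite {l :: nat multiset. set_mset l \<subseteq> {..d} \<and> size l = n}"
proof (rule finite_subset)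
  show "{l :: nat multiset. set_mset l \<subseteq> {..d} \<and> size l = n} \<subseteq> mset ` {xs. set xs \<subseteq> {..d} \<and> length xs = n}"
  proof
    fix l assume "l \<in> {l :: nat multiset. set_mset l \<subseteq> {..d} \<and> size l = n}"
    moreover obtain xs where "mset xs = l" using ex_mset by blast
    ultimately show "l \<in> mset ` {xs. set xs \<subseteq> {..d} \<and> length xs = n}" by auto
  qed
qed (simp add: finite_lists_length_eq)

text \<open>Induction on a strict bound for the number of variables in the monomials of
  \<open>f\<close>. By triangularity, a combination of the \<open>p_prod l\<close> with
  \<open>n\<close> parts removes all monomials in \<open>n\<close> variables and creates none with
  more.\<close>

lemma surj_poly_eval_p_prod: "surj (poly_eval p_prod)"
proof -
  have "f \<in> range (poly_eval p_prod)"
    if "\<And>m. sf_coeff f m \<noteq> 0 \<Longrightarrow> card (Poly_Mapping.keys m) < n" for n f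
    using that
  proof (induction n arbitrary: f)
    case 0
    then have "f = poly_eval p_prod 0" by (intro sf_eqI) auto
    then show ?case by blast
  next
    case (Suc n)
    obtain d where d: "\<And>m. sf_coeff f m \<noteq> 0 \<Longrightarrow> monom_deg m \<le> d"
      using sf_coeff[of f] by (auto simp: bounded_degree_def)
    define T where "T = {mon_type m | m. sf_coeff f m \<noteq> 0 \<and> card (Poly_Mapping.keys m) = n}"
    \<comment> \<open>Bounded degree bounds the parts, so only finitely many types occur.\<close>
    have "T \<subseteq> {l. set_mset l \<subseteq> {..d} \<and> size l = n}"
    proof
      fix l assume "l \<in> T"
      then obtain m where m: "l = mon_type m" "sf_coeff f m \<noteq> 0" "card (Poly_Mapping.keys m) = n"
        by (auto simp: T_def)
      have "Poly_Mapping.lookup m i - 1 \<le> d" for i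
        using monom_deg_minus_single(2)[of "Poly_Mapping.lookup m i" m i] d[OF m(2)] by simp
      then have "set_mset l \<subseteq> {..d}" by (auto simp: m(1) mon_type_def)
      then show "l \<in> {l. set_mset l \<subseteq> {..d} \<and> size l = n}" using m by simp
    qed
    then have fin: "finite T" by (rule finite_subset) (rule finite_mon_types)
    define M where "M l = (SOME m. mon_type m = l)" for l
    have M: "mon_type (M l) = l" if "l \<in> T" for l
      unfolding M_def by (rule someI_ex) (use that in \<open>auto simp: T_def\<close>)
    \<comment> \<open>The coefficient is fitted at one representative of each type; symmetry
      transfers this to all monomials of that type.\<close>
    define a where "a l = sf_coeff f (M l) / sf_coeff (p_prod l) (M l)" for l
    define r where "r = (\<Sum>l\<in>T. Poly_Mapping.single l (a l))"
    have er: "sf_coeff (poly_eval p_prod r) m = (\<Sum>l\<in>T. a l * sf_coeff (p_prod l) m)" for m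
      by (simp add: r_def poly_eval_sum)
    have sz: "size l = n" if "l \<in> T" for l using that by (auto simp: T_def)
    have "f - poly_eval p_prod r \<in> range (poly_eval p_prod)"
    proof (rule Suc.IH)
      fix m assume nz: "sf_coeff (f - poly_eval p_prod r) m \<noteq> 0"
      have le: "card (Poly_Mapping.keys m) \<le> n"
      proof (rule ccontr)
        assume "\<not> ?thesis"
        then have "sf_coeff f m = 0" "\<And>l. l \<in> T \<Longrightarrow> sf_coeff (p_prod l) m = 0"
          using Suc.prems[of m] p_prod_nonzero(1)[of _ m] sz by auto
        then show False using nz by (simp add: er)
      qed
      moreover have False if eq: "card (Poly_Mapping.keys m) = n"
      proof -
        have z: "sf_coeff (p_prod l) m = 0" if "l \<in> T" "l \<noteq> mon_type m" for l
          using that p_prod_nonzero(2)[of l m] sz eq by auto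
        show False
        proof (cases "mon_type m \<in> T")
          case True
          let ?l = "mon_type m"
          have "sf_coeff (poly_eval p_prod r) m = a ?l * sf_coeff (p_prod ?l) m"
            unfolding er sum.remove[OF fin True] using z by (simp add: sum.neutral)
          also have "\<dots> = sf_coeff f m"
            using sf_coeff_cong_mon_type[OF M[OF True]] p_prod_diag[OF refl, of m] by (simp add: a_def)
          finally show False using nz by simp
        next
          case False
          then have "sf_coeff f m = 0" using eq by (auto simp: T_def)
          moreover have "sf_coeff (poly_eval p_prod r) m = 0"
            unfolding er by (rule sum.neutral) (use False z in auto)
          ultimately show False using nz by simp
        qed
      qed
      ultimately show "card (Poly_Mapping.keys m) < n" by fastforce
    qed
    then obtain s where "f - poly_eval p_prod r = poly_eval p_prod s" by blast
    then have "f = poly_eval p_prod (s + r)" by (simp add: poly_eval_add algebra_simps)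
    then show ?case by blast
  qed
  note main = this
  have "f \<in> range (poly_eval p_prod)" for f
  proof -
    obtain d where d: "\<And>m. sf_coeff f m \<noteq> 0 \<Longrightarrow> monom_deg m \<le> d"
      using sf_coeff[of f] by (auto simp: bounded_degree_def)
    \<comment> \<open>Every occurring variable has exponent at least 1, so bounded degree supplies
      the bound for the induction.\<close>
    have "card (Poly_Mapping.keys m) \<le> monom_deg m" for m
      unfolding monom_deg_def
      by (rule order_trans[OF _ sum_mono[of _ "\<lambda>_. 1"]]) (auto simp: in_keys_iff)
    then show ?thesis using d by (intro main[of f "Suc d"]) (meson le_imp_less_Suc order_trans)
  qed
  then show ?thesis by blast
qed

section \<open>Homomorphisms prescribed on the power sums\<close>

lemma sf_alg_homD:
  assumes "sf_alg_hom \<phi>"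
  shows "\<phi> (sf_const c) = sf_const c" "\<phi> (f + g) = \<phi> f + \<phi> g" "\<phi> (f * g) = \<phi> f * \<phi> g"
    "\<phi> 0 = 0" "\<phi> 1 = 1" "\<phi> (of_nat n) = of_nat n" "\<phi> (- f) = - \<phi> f" "\<phi> (f - g) = \<phi> f - \<phi> g"
    "\<phi> (sum F A) = (\<Sum>a\<in>A. \<phi> (F a))" "\<phi> (prod F A) = (\<Prod>a\<in>A. \<phi> (F a))" "\<phi> (f ^ n) = \<phi> f ^ n"
    "\<phi> (prod_mset (image_mset F l)) = prod_mset (image_mset (\<lambda>a. \<phi> (F a)) l)"
proof -
  show c: "\<phi> (sf_const c) = sf_const c" and a: "\<phi> (f + g) = \<phi> f + \<phi> g" and m: "\<phi> (f * g) = \<phi> f * \<phi> g"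
    for c f g using assms by (auto simp: sf_alg_hom_def)
  show 0: "\<phi> 0 = 0" and 1: "\<phi> 1 = 1" using c[of 0] c[of 1] by simp_all
  show "\<phi> (of_nat n) = of_nat n" using c[of "of_nat n"] by (simp add: sf_const_of_nat)
  show "\<phi> (- f) = - \<phi> f" using a[of f "- f"] 0 by (simp add: add_eq_0_iff)
  show "\<phi> (f - g) = \<phi> f - \<phi> g" using a[of "f - g" g] by simp
  show "\<phi> (sum F A) = (\<Sum>a\<in>A. \<phi> (F a))"
    by (induction A rule: infinite_finite_induct) (auto simp: 0 a)
  show "\<phi> (prod F A) = (\<Prod>a\<in>A. \<phi> (F a))"
    by (induction A rule: infinite_finite_induct) (auto simp: 1 m)
  show "\<phi> (f ^ n) = \<phi> f ^ n" by (induction n) (auto simp: 1 m)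
  show "\<phi> (prod_mset (image_mset F l)) = prod_mset (image_mset (\<lambda>a. \<phi> (F a)) l)"
    by (induction l) (auto simp: 1 m)
qed

lemma sf_alg_hom_poly_eval:
  assumes "sf_alg_hom \<phi>"
  shows "\<phi> (poly_eval p_prod r) = poly_eval (\<lambda>l. prod_mset (image_mset (\<lambda>i. \<phi> (sf_p (Suc i))) l)) r"
  unfolding poly_eval_def sf_alg_homD[OF assms] p_prod_def ..

lemma sf_alg_hom_unique:
  assumes "sf_alg_hom \<phi>" "sf_alg_hom \<psi>" "\<And>k. k \<ge> 1 \<Longrightarrow> \<phi> (sf_p k) = \<psi> (sf_p k)"
  shows "\<phi> = \<psi>"
proof
  fix f
  obtain r where "f = poly_eval p_prod r" using surj_poly_eval_p_prod by (metis surjD)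
  then show "\<phi> f = \<psi> f"
    by (simp add: sf_alg_hom_poly_eval[OF assms(1)] sf_alg_hom_poly_eval[OF assms(2)] assms(3))
qed

text \<open>A symmetric function is expanded in products of power sums, via the inverse
  \<open>I\<close> of the bijection \<open>poly_eval p_prod\<close>, and evaluated again with
  \<open>g k\<close> in place of \<open>p_k\<close>. \<open>I\<close> is multiplicative because the
  evaluation is.\<close>

lemma sf_alg_hom_exists:
  fixes g :: "nat \<Rightarrow> symfun"
  obtains \<phi> where "sf_alg_hom \<phi>" "\<And>k. k \<ge> 1 \<Longrightarrow> \<phi> (sf_p k) = g k"
proof -
  define P where "P l = prod_mset (image_mset (\<lambda>i. g (Suc i)) l)" for l
  define I where "I = inv_into UNIV (poly_eval p_prod)"
  define \<phi> where "\<phi> f = poly_eval P (I f)" for f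
  have I: "I (poly_eval p_prod r) = r" "poly_eval p_prod (I f) = f" for r f
    by (simp_all add: I_def inv_f_f[OF inj_poly_eval_p_prod] surj_f_inv_f[OF surj_poly_eval_p_prod])
  have pm: "poly_eval p_prod (r * s) = poly_eval p_prod r * poly_eval p_prod s" for r s
    by (rule poly_eval_mult) (simp add: p_prod_def)
  have Pm: "poly_eval P (r * s) = poly_eval P r * poly_eval P s" for r s
    by (rule poly_eval_mult) (simp add: P_def)
  have "I (f + g) = I f + I g" "I (f * g) = I f * I g" for f g
    using I poly_eval_add pm by metis+
  moreover have "I (sf_const c) = Poly_Mapping.single {#} c" for c
    using I(1)[of "Poly_Mapping.single {#} c"] by (simp add: p_prod_empty)
  ultimately have "sf_alg_hom \<phi>"
    by (simp add: sf_alg_hom_def \<phi>_def poly_eval_add Pm P_def)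
  moreover have "\<phi> (sf_p k) = g k" if "k \<ge> 1" for k
  proof -
    have "poly_eval p_prod (Poly_Mapping.single {#k - 1#} 1) = sf_p k"
      using that by (simp add: p_prod_def)
    then have "I (sf_p k) = Poly_Mapping.single {#k - 1#} 1" using I(1) by metis
    then show ?thesis using that by (simp add: \<phi>_def P_def)
  qed
  ultimately show ?thesis using that by blast
qed

section \<open>Plethysm and the involution omega\<close>

text \<open>Existence and uniqueness of a homomorphism with prescribed values on the power sums make
  the definite description in \<open>plethysm\<close> denote it.\<close>

lemma plethysm_props:
  "sf_alg_hom (\<lambda>f. plethysm f g)" "k \<ge> 1 \<Longrightarrow> plethysm (sf_p k) g = sf_subst_power k g"
proof -
  let ?Q = "\<lambda>\<phi>. sf_alg_hom \<phi> \<and> (\<forall>k\<ge>1. \<phi> (sf_p k) = sf_subst_power k g)"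
  obtain \<phi> where \<phi>: "sf_alg_hom \<phi>" "\<And>k. k \<ge> 1 \<Longrightarrow> \<phi> (sf_p k) = sf_subst_power k g"
    using sf_alg_hom_exists[of "\<lambda>k. sf_subst_power k g"] by blast
  have uniq: "\<psi> = \<phi>" if "?Q \<psi>" for \<psi>
    by (rule sf_alg_hom_unique) (use that \<phi> in simp_all)
  have "(\<lambda>f. plethysm f g) = (THE \<phi>. ?Q \<phi>)" by (simp add: plethysm_def)
  also have "\<dots> = \<phi>" by (rule the_equality) (use \<phi> uniq in blast)+
  finally have eq: "(\<lambda>f. plethysm f g) = \<phi>" .
  show "sf_alg_hom (\<lambda>f. plethysm f g)" unfolding eq by (rule \<phi>)
  show "k \<ge> 1 \<Longrightarrow> plethysm (sf_p k) g = sf_subst_power k g" using \<phi>(2) fun_cong[OF eq] by simp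
qed

text \<open>The signs turn Newton's identity for \<open>sf_h\<close> into the one for
  \<open>sf_e\<close>, so the homomorphism with these values on power sums sends \<open>h_n\<close>
  to \<open>e_n\<close>. Conversely, the identity for \<open>sf_h\<close> can be solved for
  \<open>p_n\<close>, so the values at the \<open>h_n\<close> determine a homomorphism.\<close>

lemma omega_props:
  "sf_alg_hom omega" "k \<ge> 1 \<Longrightarrow> omega (sf_p k) = (-1) ^ (k - 1) * sf_p k"
proof -
  let ?Q = "\<lambda>\<phi>. sf_alg_hom \<phi> \<and> (\<forall>n. \<phi> (sf_h n) = sf_e n)"
  obtain \<phi> where \<phi>: "sf_alg_hom \<phi>" "\<And>k. k \<ge> 1 \<Longrightarrow> \<phi> (sf_p k) = (-1) ^ (k - 1) * sf_p k"
    using sf_alg_hom_exists[of "\<lambda>k. (-1) ^ (k - 1) * sf_p k"] by blast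
  note hom = sf_alg_homD[OF \<phi>(1)]
  have "\<phi> (sf_h n) = sf_e n" for n
  proof (induction n rule: less_induct)
    case (less n)
    show ?case
    proof (cases "n = 0")
      case False
      have "of_nat n * \<phi> (sf_h n) = \<phi> (of_nat n * sf_h n)" by (simp add: hom)
      also have "\<dots> = (\<Sum>k=1..n. (-1) ^ (k - 1) * (sf_p k * sf_e (n - k)))"
        unfolding sf_h_newton hom by (rule sum.cong) (auto simp: \<phi>(2) less mult.assoc)
      also have "\<dots> = of_nat n * sf_e n" by (rule sf_e_newton[symmetric])
      finally show ?thesis using False sf_of_nat_mult_cancel by blast
    next
      case True
      then show ?thesis using hom(5) by simp
    qed
  qed
  then have Q: "?Q \<phi>" using \<phi> by simp
  have uniq: "\<psi> = \<phi>" if "?Q \<psi>" for \<psi>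
  proof (rule sf_alg_hom_unique)
    show \<psi>: "sf_alg_hom \<psi>" "sf_alg_hom \<phi>" using that \<phi> by auto
    fix n :: nat assume "n \<ge> 1"
    then show "\<psi> (sf_p n) = \<phi> (sf_p n)"
    proof (induction n rule: less_induct)
      case (less n)
      \<comment> \<open>The term \<open>k = n\<close> of Newton's identity is \<open>p_n\<close>
        itself, since \<open>h_0 = 1\<close>.\<close>
      have h: "sf_p n = of_nat n * sf_h n - (\<Sum>k\<in>{1..n} - {n}. sf_p k * sf_h (n - k))"
        unfolding sf_h_newton
        by (subst sum.remove[of "{1..n}" n "\<lambda>k. sf_p k * sf_h (n - k)"]) (use less.prems in auto)
      have e: "\<theta> (sf_p n) = of_nat n * sf_e n - (\<Sum>k\<in>{1..n} - {n}. \<theta> (sf_p k) * sf_e (n - k))"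
        if \<theta>: "?Q \<theta>" for \<theta>
      proof -
        from \<theta> have "sf_alg_hom \<theta>" by simp
        then show ?thesis unfolding h using \<theta> by (simp only: sf_alg_homD[OF \<open>sf_alg_hom \<theta>\<close>] simp_thms)
      qed
      show ?case unfolding e[OF that] e[OF Q] using less.IH by (auto intro!: sum.cong)
    qed
  qed
  have "omega = \<phi>" unfolding omega_def using Q uniq by (rule the_equality)
  then show "sf_alg_hom omega" "k \<ge> 1 \<Longrightarrow> omega (sf_p k) = (-1) ^ (k - 1) * sf_p k"
    using \<phi> by simp_all
qed

section \<open>Logarithmic derivatives of power series\<close>

text \<open>\<open>B\<close> stands for \<open>t F' / F\<close>. The relation is stated without a
  quotient, so that on coefficients it becomes the recursion of
  \<open>log_deriv_iff\<close>.\<close>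

definition log_deriv :: "symfun fps \<Rightarrow> symfun fps \<Rightarrow> bool" where
  "log_deriv F B \<longleftrightarrow> fps_nth F 0 = 1 \<and> fps_X * fps_deriv F = B * F"

lemma fps_X_deriv_nth: "fps_nth (fps_X * fps_deriv F) n = of_nat n * fps_nth F n"
  for F :: "symfun fps"
  by (cases n) simp_all

lemma log_deriv_iff:
  "log_deriv F B \<longleftrightarrow> fps_nth F 0 = 1
    \<and> (\<forall>n. of_nat n * fps_nth F n = (\<Sum>i=0..n. fps_nth B i * fps_nth F (n - i)))"
  unfolding log_deriv_def fps_eq_iff fps_X_deriv_nth fps_mult_nth[of B F] ..

lemma log_deriv_0: "log_deriv F B \<Longrightarrow> fps_nth B 0 = 0"
  by (auto simp: log_deriv_iff dest: spec[of _ 0])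

lemma log_deriv_one: "log_deriv 1 0"
  by (simp add: log_deriv_def)

lemma log_deriv_mult:
  assumes "log_deriv F B" "log_deriv G C"
  shows "log_deriv (F * G) (B + C)"
proof -
  have "fps_X * fps_deriv (F * G) = F * (fps_X * fps_deriv G) + (fps_X * fps_deriv F) * G"
    by (simp add: algebra_simps)
  also have "\<dots> = (B + C) * (F * G)"
    using assms unfolding log_deriv_def by (simp only:) (simp add: algebra_simps)
  finally show ?thesis using assms by (simp add: log_deriv_def)
qed

lemma log_deriv_prod:
  assumes "\<And>i. i \<in> A \<Longrightarrow> log_deriv (F i) (B i)"
  shows "log_deriv (prod F A) (sum B A)"
  using assms
  by (induction A rule: infinite_finite_induct) (auto intro: log_deriv_one log_deriv_mult)

text \<open>As \<open>B\<close> has constant term 0, the recursion expresses \<open>n\<close> times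
  the \<open>n\<close>th coefficient by earlier ones, and \<open>n\<close> can be cancelled.\<close>

lemma log_deriv_unique:
  assumes "log_deriv F B" "log_deriv G B"
  shows "F = G"
proof (rule fps_ext)
  fix n
  show "fps_nth F n = fps_nth G n"
  proof (induction n rule: less_induct)
    case (less n)
    show ?case
    proof (cases "n = 0")
      case True
      then show ?thesis using assms by (simp add: log_deriv_iff)
    next
      case False
      have "of_nat n * fps_nth F n = (\<Sum>i=0..n. fps_nth B i * fps_nth F (n - i))"
        using assms(1) by (simp add: log_deriv_iff)
      also have "\<dots> = (\<Sum>i=0..n. fps_nth B i * fps_nth G (n - i))"
      proof (rule sum.cong[OF refl])
        fix i assume "i \<in> {0..n}"
        show "fps_nth B i * fps_nth F (n - i) = fps_nth B i * fps_nth G (n - i)"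
          using less[of "n - i"] log_deriv_0[OF assms(1)] False by (cases "i = 0") auto
      qed
      also have "\<dots> = of_nat n * fps_nth G n"
        using assms(2) by (simp add: log_deriv_iff)
      finally show ?thesis using False sf_of_nat_mult_cancel by blast
    qed
  qed
qed

lemma fps_mult_unit_inv:
  assumes "fps_nth F 0 = 1"
  shows "F * unit_inv F = 1"
proof -
  have ex: "F * fps_right_inverse F 1 = 1"
    using assms by (intro fps_right_inverse) simp
  have "unit_inv F = fps_right_inverse F 1"
    unfolding unit_inv_def
  proof (rule the_equality)
    show "F * fps_right_inverse F 1 = 1" by (rule ex)
    fix G assume "F * G = 1"
    then show "G = fps_right_inverse F 1"
      using ex by (metis mult.assoc mult.commute mult_1)
  qed
  then show ?thesis using ex by simp
qed

text \<open>The equation \<open>F * unit_inv F = 1\<close> is differentiated and multiplied by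
  \<open>unit_inv F\<close>.\<close>

lemma log_deriv_unit_inv:
  assumes "log_deriv F B"
  shows "log_deriv (unit_inv F) (- B)"
proof -
  let ?G = "unit_inv F"
  have F0: "fps_nth F 0 = 1" and F: "fps_X * fps_deriv F = B * F"
    using assms by (simp_all add: log_deriv_def)
  have G: "F * ?G = 1" using F0 by (rule fps_mult_unit_inv)
  then have "fps_nth (F * ?G) 0 = 1" by simp
  then have G0: "fps_nth ?G 0 = 1" using F0 by simp
  have "fps_deriv (F * ?G) = 0" unfolding G by simp
  then have "F * (fps_X * fps_deriv ?G) + (fps_X * fps_deriv F) * ?G = 0"
    by (metis (no_types, lifting) distrib_left fps_deriv_mult mult.assoc mult.left_commute mult_zero_right)
  then have "F * (fps_X * fps_deriv ?G) + B * (F * ?G) = 0"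
    by (simp add: F mult.assoc)
  then have "F * (fps_X * fps_deriv ?G) = - B" by (simp add: G add_eq_0_iff2)
  then have "(F * ?G) * (fps_X * fps_deriv ?G) = - B * ?G"
    by (metis mult.commute mult.left_commute)
  then show ?thesis using G G0 by (simp add: log_deriv_def)
qed

section \<open>Infinite products\<close>

text \<open>If the logarithmic derivative starts in degree \<open>n\<close>, the series is
  \<open>1 + O(t^n)\<close>; this makes the infinite products converge.\<close>

lemma log_deriv_low_coeff:
  assumes "log_deriv F B" "\<And>k. k < n \<Longrightarrow> fps_nth B k = 0" "0 < k" "k < n"
  shows "fps_nth F k = 0"
proof -
  have "of_nat k * fps_nth F k = (\<Sum>i=0..k. fps_nth B i * fps_nth F (k - i))"
    using assms(1) by (simp add: log_deriv_iff)
  also have "\<dots> = of_nat k * 0" using assms(2,4) by simp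
  finally show ?thesis using assms(3) sf_of_nat_mult_cancel by blast
qed

text \<open>Factor \<open>n\<close> is \<open>1 + O(t^n)\<close>, so the coefficient of
  \<open>t^k\<close> is stable from the \<open>k\<close>th partial product on. The recursion for
  coefficient \<open>n\<close> involves no later ones and can be read off the \<open>n\<close>th
  partial product.\<close>

lemma log_deriv_prod_over:
  assumes pos: "\<And>n. n \<in> A \<Longrightarrow> n > 0"
    and ld: "\<And>n. n \<in> A \<Longrightarrow> log_deriv (f n) (b n)"
    and low: "\<And>n k. n \<in> A \<Longrightarrow> k < n \<Longrightarrow> fps_nth (b n) k = 0"
  shows "log_deriv (prod_over A f) (Abs_fps (\<lambda>k. \<Sum>n\<in>A \<inter> {..k}. fps_nth (b n) k))"
proof -
  define g where "g n = (if n \<in> A then f n else 1)" for n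
  define c where "c n = (if n \<in> A then b n else 0)" for n
  define P where "P N = (\<Prod>n\<le>N. g n)" for N
  define L where "L = Abs_fps (\<lambda>k. fps_nth (P k) k)"
  have g: "log_deriv (g n) (c n)" for n
    using ld by (simp add: g_def c_def log_deriv_one)
  have g0: "fps_nth (g n) 0 = 1" for n using g by (simp add: log_deriv_def)
  have clow: "fps_nth (c n) k = 0" if "k < n" for n k using low that by (simp add: c_def)
  have gk: "fps_nth (g n) k = 0" if "0 < k" "k < n" for n k
    using log_deriv_low_coeff[OF g clow that] .
  have Pld: "log_deriv (P N) (\<Sum>n\<le>N. c n)" for N
    unfolding P_def by (rule log_deriv_prod) (rule g)
  have PSuc: "fps_nth (P (Suc N)) k = fps_nth (P N) k" if "k \<le> N" for N k
  proof -
    have "fps_nth (P (Suc N)) k = (\<Sum>i=0..k. fps_nth (P N) i * fps_nth (g (Suc N)) (k - i))"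
      by (simp add: P_def fps_mult_nth)
    also have "\<dots> = (\<Sum>i=0..k. if i = k then fps_nth (P N) k else 0)"
      using gk that g0 by (intro sum.cong) auto
    finally show ?thesis by simp
  qed
  have PL: "fps_nth (P N) k = fps_nth L k" if "k \<le> N" for N k
    using that
  proof (induction N rule: dec_induct)
    case base
    then show ?case by (simp add: L_def)
  next
    case (step N)
    then show ?case using PSuc by simp
  qed
  have P_eq: "P = (\<lambda>N. \<Prod>n\<le>N. g n)" by (rule ext) (rule P_def)
  have L0: "fps_nth L 0 = 1" using Pld[of 0] by (simp add: L_def log_deriv_def)
  have lim: "P \<longlonglongrightarrow> L"
  proof (rule tendsto_fpsI)
    show "\<forall>\<^sub>F N in sequentially. fps_nth (P N) k = fps_nth L k" for k
      using eventually_ge_at_top[of k] by eventually_elim (rule PL)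
  qed
  \<comment> \<open>\<open>has_prod\<close> also admits the value 0 when a factor vanishes; nonzero
    factors leave plain convergence of the partial products.\<close>
  have gnz: "g n \<noteq> 0" for n using g0[of n] by auto
  have "prodinf g = L"
    unfolding prodinf_def
  proof (rule the_equality)
    show "g has_prod L"
      using lim L0 by (auto simp: has_prod_def raw_has_prod_def P_eq)
    fix p assume "g has_prod p"
    then have "P \<longlonglongrightarrow> p"
      using gnz by (auto simp: has_prod_def raw_has_prod_def P_eq)
    then show "p = L" using lim by (rule LIMSEQ_unique)
  qed
  moreover have "g = (\<lambda>n. if n \<in> A then f n else 1)" by (rule ext) (rule g_def)
  ultimately have eq: "prod_over A f = L" by (simp add: prod_over_def)
  have csum: "fps_nth (\<Sum>n\<le>N. c n) k = (\<Sum>n\<in>A \<inter> {..k}. fps_nth (b n) k)" if "k \<le> N" for N k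
  proof -
    have "fps_nth (\<Sum>n\<le>N. c n) k = (\<Sum>n\<le>N. fps_nth (c n) k)" by (simp add: fps_sum_nth)
    also have "\<dots> = (\<Sum>n\<in>A \<inter> {..k}. fps_nth (b n) k)"
      by (rule sum.mono_neutral_cong_right) (use that low in \<open>auto simp: c_def not_le[symmetric]\<close>)
    finally show ?thesis .
  qed
  show ?thesis
    unfolding eq log_deriv_iff
  proof (intro conjI allI)
    fix n
    have "of_nat n * fps_nth L n = of_nat n * fps_nth (P n) n" by (simp add: L_def)
    also have "\<dots> = (\<Sum>i=0..n. fps_nth (\<Sum>n\<le>n. c n) i * fps_nth (P n) (n - i))"
      using Pld[of n] by (simp add: log_deriv_iff)
    also have "\<dots> = (\<Sum>i=0..n. fps_nth (Abs_fps (\<lambda>k. \<Sum>n\<in>A \<inter> {..k}. fps_nth (b n) k)) i * fps_nth L (n - i))"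
      by (intro sum.cong refl) (simp add: csum PL)
    finally show "of_nat n * fps_nth L n = \<dots>" .
  qed (rule L0)
qed

text \<open>This is the geometric series
  \<open>t F' / F = - n (a t^n + a^2 t^(2n) + ...)\<close>.\<close>

lemma log_deriv_one_minus:
  assumes "n > 0"
  shows "log_deriv (1 - fps_X ^ n * fps_const a)
    (Abs_fps (\<lambda>k. if k > 0 \<and> n dvd k then - of_nat n * a ^ (k div n) else 0))"
    (is "log_deriv ?F ?B")
proof -
  have "fps_X * fps_deriv ?F = - (of_nat n * (fps_X ^ n * fps_const a))"
    by (rule fps_ext)
       (simp add: fps_X_deriv_nth fps_X_power_mult_nth mult.assoc fps_of_nat[symmetric])
  moreover have "?B * ?F = - (of_nat n * (fps_X ^ n * fps_const a))"
  proof (rule fps_ext)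
    fix k
    \<comment> \<open>The recursion of the geometric series, started by its first term at
      \<open>k = n\<close>.\<close>
    have B: "fps_nth ?B k = (if k < n then 0 else a * fps_nth ?B (k - n))
        + (if k = n then - of_nat n * a else 0)"
    proof (cases "k < n")
      case True
      then show ?thesis by (auto dest: dvd_imp_le)
    next
      case False
      then obtain j where "k = n + j" using le_Suc_ex not_less by blast
      then show ?thesis using assms by (auto simp: algebra_simps)
    qed
    have "?B * ?F = ?B - fps_X ^ n * ?B * fps_const a" by (simp add: algebra_simps)
    then have "fps_nth (?B * ?F) k = fps_nth ?B k - (if k < n then 0 else a * fps_nth ?B (k - n))"
      by (simp add: fps_X_power_mult_nth mult.commute)
    also have "\<dots> = (if k = n then - of_nat n * a else 0)" by (subst B) simp
    also have "\<dots> = fps_nth (- (of_nat n * (fps_X ^ n * fps_const a))) k"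
      by (simp add: fps_of_nat[symmetric] mult.assoc[symmetric] fps_X_power_mult_nth fps_mult_nth_0)
    finally show "fps_nth (?B * ?F) k = \<dots>" .
  qed
  ultimately show ?thesis using assms by (simp add: log_deriv_def)
qed

text \<open>Being a ring homomorphism, \<open>omega\<close> preserves the coefficient
  recursion.\<close>

lemma log_deriv_omega_series:
  assumes "log_deriv F B"
  shows "log_deriv (omega_series F) (omega_series B)"
proof -
  note hom = sf_alg_homD[OF omega_props(1)]
  have "of_nat n * omega (fps_nth F n) = omega (of_nat n * fps_nth F n)" for n
    by (simp add: hom)
  also have "\<dots> n = (\<Sum>i=0..n. omega (fps_nth B i) * omega (fps_nth F (n - i)))" for n
    using assms by (simp add: log_deriv_iff hom)
  finally show ?thesis
    using assms by (simp add: log_deriv_iff omega_series_def hom)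
qed

section \<open>The series \<open>E[Q](t)\<close>\<close>

lemma finite_partitions_of: "finite (partitions_of n)"
proof (rule finite_subset)
  show "partitions_of n \<subseteq> (\<Union>s\<le>n. {l. set_mset l \<subseteq> {..n} \<and> size l = s})"
  proof
    fix l assume "l \<in> partitions_of n"
    then have l: "0 \<notin># l" "sum_mset l = n" by (auto simp: partitions_of_def)
    have "size l \<le> n"
      using l(1) unfolding l(2)[symmetric] by (induction l) auto
    moreover have "x \<le> n" if "x \<in># l" for x
      using that l(2) by (metis le_add1 mset_add sum_mset.add_mset)
    ultimately show "l \<in> (\<Union>s\<le>n. {l. set_mset l \<subseteq> {..n} \<and> size l = s})" by auto
  qed
qed (use finite_mon_types in auto)

text \<open>Both factors are kept for the sake of reindexing. For \<open>n = 0\<close> the set is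
  infinite, so sums over it are meaningful only for positive \<open>n\<close>.\<close>

definition divpairs :: "nat \<Rightarrow> (nat \<times> nat) set" where
  "divpairs n = {(i, k). i * k = n}"

lemma finite_divpairs [simp]:
  assumes "n > 0"
  shows "finite (divpairs n)"
proof (rule finite_subset)
  show "divpairs n \<subseteq> {..n} \<times> {..n}" using assms by (auto simp: divpairs_def)
qed simp

text \<open>Newton's identity for \<open>sf_e\<close> is mapped by the homomorphism
  \<open>f \<mapsto> f[g]\<close>, which sends \<open>p_k\<close> to
  \<open>sf_subst_power k g\<close>.\<close>

lemma e_plethysm_newton:
  "of_nat m * plethysm (sf_e m) g
    = (\<Sum>k=1..m. (-1) ^ (k - 1) * sf_subst_power k g * plethysm (sf_e (m - k)) g)"
proof -
  note hom = sf_alg_homD[OF plethysm_props(1)[of g]]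
  have "of_nat m * plethysm (sf_e m) g = plethysm (of_nat m * sf_e m) g" by (simp add: hom)
  also have "\<dots> = (\<Sum>k=1..m. (-1) ^ (k - 1) * sf_subst_power k g * plethysm (sf_e (m - k)) g)"
    unfolding sf_e_newton by (simp add: hom plethysm_props(2) mult.assoc cong: sum.cong_simp)
  finally show ?thesis .
qed

lemma plethysm_1 [simp]: "plethysm 1 g = 1"
  using sf_alg_homD(5)[OF plethysm_props(1)[of g]] .

text \<open>Numbers that are not parts contribute \<open>e_0[q_i] = 1\<close>.\<close>

lemma E_part_superset:
  assumes "finite A" "set_mset l \<subseteq> A"
  shows "E_part q l = (\<Prod>i\<in>A. plethysm (sf_e (count l i)) (q i))"
  unfolding E_part_def
  by (rule prod.mono_neutral_left) (use assms in \<open>auto simp: not_in_iff\<close>)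

lemma sum_mset_count:
  assumes "finite A" "set_mset l \<subseteq> A"
  shows "sum_mset l = (\<Sum>i\<in>A. i * count l i)"
  using assms(2)
proof (induction l)
  case (add x l)
  have "(\<Sum>i\<in>A. i * count (add_mset x l) i) = (\<Sum>i\<in>A. i * count l i + (if i = x then x else 0))"
    by (rule sum.cong) auto
  then show ?case using add assms(1) by (simp add: sum.distrib)
qed simp

text \<open>The sum of \<open>l\<close> is the sum of \<open>i\<close> times its multiplicity over
  the distinct parts \<open>i\<close>. In the summand of \<open>i\<close>, Newton's identity is
  applied to the factor \<open>e_m[q_i]\<close>; lowering its index by \<open>k\<close> amounts to
  deleting \<open>k\<close> copies of \<open>i\<close>.\<close>

lemma E_part_newton:
  "of_nat (sum_mset l) * E_part q l = (\<Sum>i\<in>set_mset l. \<Sum>k=1..count l i.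
      of_nat i * ((-1) ^ (k - 1) * sf_subst_power k (q i)) * E_part q (l - replicate_mset k i))"
proof -
  let ?e = "\<lambda>i m. plethysm (sf_e m) (q i)"
  have "of_nat (i * count l i) * E_part q l = (\<Sum>k=1..count l i.
      of_nat i * ((-1) ^ (k - 1) * sf_subst_power k (q i)) * E_part q (l - replicate_mset k i))"
    if i: "i \<in># l" for i
  proof -
    let ?R = "\<Prod>j\<in>set_mset l - {i}. ?e j (count l j)"
    have E: "E_part q (l - replicate_mset k i) = ?e i (count l i - k) * ?R" for k
    proof -
      have "E_part q (l - replicate_mset k i)
          = (\<Prod>j\<in>set_mset l. ?e j (count (l - replicate_mset k i) j))"
        by (rule E_part_superset) (auto dest: in_diffD)
      then show ?thesis using i by (simp add: prod.remove[of "set_mset l" i])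
    qed
    have "of_nat (i * count l i) * E_part q l = of_nat i * (of_nat (count l i) * ?e i (count l i)) * ?R"
      using E[of 0] by (simp add: mult.assoc)
    also have "\<dots> = (\<Sum>k=1..count l i.
        of_nat i * ((-1) ^ (k - 1) * sf_subst_power k (q i)) * (?e i (count l i - k) * ?R))"
      unfolding e_plethysm_newton by (simp add: sum_distrib_left sum_distrib_right mult.assoc)
    finally show ?thesis by (simp add: E)
  qed
  moreover have "sum_mset l = (\<Sum>i\<in>set_mset l. i * count l i)"
    by (rule sum_mset_count) simp_all
  then have "of_nat (sum_mset l) * E_part q l = (\<Sum>i\<in>set_mset l. of_nat (i * count l i) * E_part q l)"
    by (simp add: sum_distrib_right)
  ultimately show ?thesis by (simp cong: sum.cong_simp)
qed

definition E_log_coeff :: "(nat \<Rightarrow> symfun) \<Rightarrow> nat \<Rightarrow> symfun" where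
  "E_log_coeff q n = (if n = 0 then 0 else
     \<Sum>(i, k)\<in>divpairs n. of_nat i * ((-1) ^ (k - 1) * sf_subst_power k (q i)))"

text \<open>
  A part \<open>i\<close> of a partition \<open>l\<close> together with some \<open>k\<close> between 1 and the multiplicity of \<open>i\<close>
  is the same as a pair \<open>(i, k)\<close> together with the partition left after removing \<open>k\<close> parts \<open>i\<close>.
\<close>

lemma log_deriv_E_series: "log_deriv (E_series q) (Abs_fps (E_log_coeff q))"
  unfolding log_deriv_iff
proof (intro conjI allI)
  have "partitions_of 0 = {{#}}"
    by (auto simp: partitions_of_def) (metis gr0I multiset_nonemptyE)
  then show "fps_nth (E_series q) 0 = 1" by (simp add: E_series_def E_part_def)
next
  fix n :: nat
  define s where "s i k = of_nat i * ((-1) ^ (k - 1) * sf_subst_power k (q i))" for i k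
  define A where "A n = (\<Sum>l\<in>partitions_of n. E_part q l)" for n
  define K where "K = {(i, k). 1 \<le> i \<and> 1 \<le> k \<and> i * k \<le> n}"
  let ?S = "\<lambda>l. Sigma (set_mset l) (\<lambda>i. {1..count l i})"
  let ?T = "\<lambda>x. partitions_of (n - fst x * snd x)"
  let ?g = "\<lambda>x. s (fst (snd x)) (snd (snd x)) * E_part q (fst x - replicate_mset (snd (snd x)) (fst (snd x)))"
  let ?h = "\<lambda>x. s (fst (fst x)) (snd (fst x)) * E_part q (snd x)"
  let ?i = "\<lambda>x. (snd x + replicate_mset (snd (fst x)) (fst (fst x)), fst x)"
  let ?j = "\<lambda>x. (snd x, fst x - replicate_mset (snd (snd x)) (fst (snd x)))"
  have finK: "finite K"
  proof (rule finite_subset)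
    show "K \<subseteq> {..n} \<times> {..n}"
    proof
      fix x assume "x \<in> K"
      then obtain i k where x: "x = (i, k)" "1 \<le> i" "1 \<le> k" "i * k \<le> n" by (auto simp: K_def)
      have "i \<le> i * k" "k \<le> i * k" using x by simp_all
      then have "i \<le> n" "k \<le> n" using x(4) by linarith+
      then show "x \<in> {..n} \<times> {..n}" by (simp add: x(1))
    qed
  qed simp
  have "of_nat n * A n = (\<Sum>l\<in>partitions_of n. of_nat (sum_mset l) * E_part q l)"
    by (simp add: A_def sum_distrib_left partitions_of_def)
  also have "\<dots> = (\<Sum>l\<in>partitions_of n. \<Sum>x\<in>?S l. s (fst x) (snd x) * E_part q (l - replicate_mset (snd x) (fst x)))"
    unfolding E_part_newton by (subst sum.Sigma) (simp_all add: s_def split_def)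
  also have "\<dots> = (\<Sum>x\<in>Sigma (partitions_of n) ?S. ?g x)"
    by (subst sum.Sigma) (auto simp: finite_partitions_of split_def)
  also have "\<dots> = (\<Sum>x\<in>Sigma K ?T. ?h x)"
  proof (rule sum.reindex_bij_witness[where i = ?i and j = ?j])
    fix a assume "a \<in> Sigma (partitions_of n) ?S"
    then obtain l i k where a: "a = (l, i, k)" "l \<in> partitions_of n" "i \<in># l" "1 \<le> k" "k \<le> count l i"
      by auto
    have sub: "replicate_mset k i \<subseteq># l" using a(5) by (simp add: count_le_replicate_mset_subset_eq)
    then have l: "l - replicate_mset k i + replicate_mset k i = l" by simp
    show "?i (?j a) = a" using l by (simp add: a(1))
    have "sum_mset l = sum_mset (l - replicate_mset k i) + i * k"
      by (subst l[symmetric], subst sum_mset.union) (simp add: mult.commute)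
    moreover have "0 \<notin># l - replicate_mset k i" using a by (auto simp: partitions_of_def dest: in_diffD)
    moreover have "i \<noteq> 0" using a by (metis (mono_tags, lifting) mem_Collect_eq partitions_of_def)
    ultimately show "?j a \<in> Sigma K ?T"
      using a by (auto simp: K_def partitions_of_def)
    show "?h (?j a) = ?g a" by (simp add: a(1))
  next
    fix b assume "b \<in> Sigma K ?T"
    then obtain i k l where b: "b = ((i, k), l)" "1 \<le> i" "1 \<le> k" "i * k \<le> n" "l \<in> partitions_of (n - i * k)"
      by (auto simp: K_def)
    show "?j (?i b) = b" by (simp add: b(1))
    show "?i b \<in> Sigma (partitions_of n) ?S"
      using b by (auto simp: partitions_of_def mult.commute)
  qed
  also have "\<dots> = (\<Sum>x\<in>K. s (fst x) (snd x) * A (n - fst x * snd x))"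
    using sum.Sigma[of K ?T "\<lambda>y l. s (fst y) (snd y) * E_part q l"]
    by (simp add: finK finite_partitions_of A_def sum_distrib_left split_def)
  also have "\<dots> = (\<Sum>(i, k)\<in>K. s i k * A (n - i * k))" by (simp add: split_def)
  \<comment> \<open>Pairs are grouped by their product \<open>N\<close>, the weight taken off the
    partition.\<close>
  also have "\<dots> = (\<Sum>N\<in>{1..n}. \<Sum>(i, k)\<in>{x \<in> K. fst x * snd x = N}. s i k * A (n - i * k))"
    by (rule sum.group[symmetric]) (use finK in \<open>auto simp: K_def\<close>)
  also have "\<dots> = (\<Sum>N\<in>{1..n}. E_log_coeff q N * A (n - N))"
  proof (rule sum.cong[OF refl])
    fix N assume N: "N \<in> {1..n}"
    have "{x \<in> K. fst x * snd x = N} = divpairs N"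
      using N by (auto simp: K_def divpairs_def Suc_le_eq intro!: gr0I)
    then have "(\<Sum>(i, k)\<in>{x \<in> K. fst x * snd x = N}. s i k * A (n - i * k))
        = (\<Sum>(i, k)\<in>divpairs N. s i k * A (n - N))"
      by (auto simp: divpairs_def intro!: sum.cong)
    also have "\<dots> = E_log_coeff q N * A (n - N)"
      using N by (simp add: E_log_coeff_def s_def sum_distrib_right split_def)
    finally show "(\<Sum>(i, k)\<in>{x \<in> K. fst x * snd x = N}. s i k * A (n - i * k))
        = E_log_coeff q N * A (n - N)" .
  qed
  also have "\<dots> = (\<Sum>N=0..n. E_log_coeff q N * A (n - N))"
    by (rule sum.mono_neutral_left) (auto simp: E_log_coeff_def Suc_le_eq)
  finally show "of_nat n * fps_nth (E_series q) n
      = (\<Sum>i=0..n. fps_nth (Abs_fps (E_log_coeff q)) i * fps_nth (E_series q) (n - i))"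
    by (simp add: E_series_def A_def)
qed

section \<open>Cyclic subgroups of the symmetric group\<close>

locale full_cycle =
  fixes n :: nat and c :: "nat \<Rightarrow> nat"
  assumes pos: "n \<ge> 1" and cyc: "n_cycle n c"
begin

lemma perm: "c permutes {1..n}" and cyclic: "cyclic_on c {1..n}"
  using cyc by (simp_all add: n_cycle_def)

lemma permutes_pow: "(c ^^ j) permutes {1..n}"
proof (induction j)
  case 0
  show ?case unfolding funpow.simps by (rule permutes_id)
next
  case (Suc j)
  show ?case unfolding funpow.simps by (rule permutes_compose[OF Suc perm])
qed

text \<open>The orbit of \<open>x\<close> is all of \<open>{1..n}\<close>, so its first return time
  is \<open>n\<close>.\<close>

lemma pow_eq_self_iff:
  assumes "x \<in> {1..n}"
  shows "(c ^^ m) x = x \<longleftrightarrow> n dvd m"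
proof -
  have orb: "orbit c x = {1..n}" using orbit_cyclic_eq3[OF cyclic assms] .
  then have self: "x \<in> orbit c x" using assms by simp
  have "n = card (orbit c x)" by (simp add: orb)
  also have "\<dots> = funpow_dist1 c x x"
    by (subst orbit_conv_funpow_dist1[OF self]) (simp add: card_image[OF inj_on_funpow_dist1[OF self]])
  finally have n: "funpow_dist1 c x x = n" ..
  then have cn: "(c ^^ n) x = x" using funpow_dist1_prop[OF self] by simp
  have "(c ^^ m) x = (c ^^ (m mod n)) x" using funpow_mod_eq[OF cn] by simp
  moreover have "(c ^^ k) x \<noteq> x" if "0 < k" "k < n" for k
    using funpow_dist1_least[of k c x x] that n by simp
  then have "(c ^^ (m mod n)) x = x \<longleftrightarrow> m mod n = 0"
    using pos by (cases "m mod n = 0") auto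
  ultimately show ?thesis by (simp add: dvd_eq_mod_eq_0)
qed

lemma pow_apply_eq_iff:
  assumes "x \<in> {1..n}"
  shows "(c ^^ a) x = (c ^^ b) x \<longleftrightarrow> a mod n = b mod n"
proof -
  have *: "(c ^^ b) x = (c ^^ a) x \<longleftrightarrow> b mod n = a mod n" if le: "a \<le> b" for a b
  proof -
    obtain d where d: "b = a + d" using le_Suc_ex[OF le] by blast
    have "(c ^^ b) x = (c ^^ a) ((c ^^ d) x)" unfolding d funpow_add o_apply ..
    then have "(c ^^ b) x = (c ^^ a) x \<longleftrightarrow> (c ^^ d) x = x"
      using inj_eq[OF permutes_inj[OF permutes_pow[of a]], of "(c ^^ d) x" x] by simp
    also have "\<dots> \<longleftrightarrow> n dvd b - a" by (simp add: pow_eq_self_iff[OF assms] d)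
    also have "\<dots> \<longleftrightarrow> b mod n = a mod n" using mod_eq_dvd_iff_nat[OF le] by blast
    finally show ?thesis .
  qed
  show ?thesis
  proof (cases "a \<le> b")
    case True
    show ?thesis unfolding eq_commute[of "(c ^^ a) x"] eq_commute[of "a mod n"] by (rule *[OF True])
  next
    case False
    then show ?thesis by (intro *) simp
  qed
qed

lemma pow_eq_iff: "c ^^ a = c ^^ b \<longleftrightarrow> a mod n = b mod n"
proof
  assume "c ^^ a = c ^^ b"
  then show "a mod n = b mod n" using pow_apply_eq_iff[of 1 a b] pos by simp
next
  assume *: "a mod n = b mod n"
  show "c ^^ a = c ^^ b"
  proof
    fix x
    show "(c ^^ a) x = (c ^^ b) x"
    proof (cases "x \<in> {1..n}")
      case False
      then show ?thesis using permutes_pow by (metis permutes_not_in)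
    qed (use * pow_apply_eq_iff in blast)
  qed
qed

text \<open>The inverse of \<open>c\<close> is its power with exponent \<open>n - 1\<close>, so the
  generated group consists of powers, which repeat modulo \<open>n\<close>.\<close>

lemma cyclic_subgroup_eq: "cyclic_subgroup n c = (\<lambda>j. c ^^ j) ` {..<n}"
proof
  interpret G: group "sym_group n" by (rule sym_group_is_group)
  have mem: "c ^^ j \<in> (\<lambda>j. c ^^ j) ` {..<n}" for j
    using pos by (intro image_eqI[of _ _ "j mod n"]) (auto simp: pow_eq_iff)
  have "c ^^ (n - 1) \<circ> c = c ^^ 0"
    using pos pow_eq_iff[of n 0] by (metis One_nat_def Suc_pred funpow_Suc_right less_le_trans mod_self mod_0 zero_less_one)
  then have inv: "inv\<^bsub>sym_group n\<^esub> c = c ^^ (n - 1)"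
    by (intro G.inv_equality)
       (simp_all only: sym_group_mult sym_group_one sym_group_carrier perm permutes_pow funpow.simps)
  show "cyclic_subgroup n c \<subseteq> (\<lambda>j. c ^^ j) ` {..<n}"
  proof
    fix g assume "g \<in> cyclic_subgroup n c"
    then show "g \<in> (\<lambda>j. c ^^ j) ` {..<n}"
      unfolding cyclic_subgroup_def
    proof (induction rule: generate.induct)
      case one
      show ?case using mem[of 0] unfolding sym_group_one funpow.simps .
    next
      case (incl h)
      then show ?case using mem[of 1] by simp
    next
      case (inv h)
      then show ?case using mem[of "n - 1"] \<open>inv\<^bsub>sym_group n\<^esub> c = _\<close> by simp
    next
      case (eng g h)
      then obtain a b where "g = c ^^ a" "h = c ^^ b" by blast
      then show ?case using mem[of "a + b"] by (simp only: sym_group_mult funpow_add)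
    qed
  qed
  have "c ^^ j \<in> cyclic_subgroup n c" for j
    unfolding cyclic_subgroup_def
  proof (induction j)
    case 0
    show ?case using generate.one[of "sym_group n" "{c}"] unfolding sym_group_one funpow.simps .
  next
    case (Suc j)
    show ?case
      using generate.eng[OF generate.incl[of c "{c}"] Suc] unfolding sym_group_mult funpow.simps by blast
  qed
  then show "(\<lambda>j. c ^^ j) ` {..<n} \<subseteq> cyclic_subgroup n c" by blast
qed

lemma inj_on_pow: "inj_on (\<lambda>j. c ^^ j) {..<n}"
  by (rule inj_onI) (simp add: pow_eq_iff)

text \<open>\<open>linear_char\<close> is a choice, so a suitable character must first be exhibited:
  \<open>z ^ j\<close> depends only on \<open>c ^^ j\<close> because \<open>z ^ n = 1\<close>.
  Multiplicativity then determines any such character on the powers of \<open>c\<close>.\<close>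

lemma linear_char_pow:
  assumes "z ^ n = 1"
  shows "linear_char n c z (c ^^ j) = z ^ j"
proof -
  let ?H = "cyclic_subgroup n c"
  let ?Q = "\<lambda>\<psi>. \<psi> c = z \<and> (\<forall>g\<in>?H. \<forall>h\<in>?H. \<psi> (g \<otimes>\<^bsub>sym_group n\<^esub> h) = \<psi> g * (\<psi> h :: complex))"
  define \<psi> where "\<psi> g = z ^ (SOME j. g = c ^^ j)" for g
  have zmod: "z ^ a = z ^ b" if "a mod n = b mod n" for a b
  proof -
    have "z ^ a = z ^ (a mod n)" for a
    proof -
      have "z ^ a = (z ^ n) ^ (a div n) * z ^ (a mod n)"
        by (simp flip: power_mult power_add)
      then show ?thesis using assms by simp
    qed
    then show ?thesis using that by metis
  qed
  have \<psi>: "\<psi> (c ^^ j) = z ^ j" for j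
  proof -
    have "c ^^ j = c ^^ (SOME i. c ^^ j = c ^^ i)" by (rule someI[of _ j]) simp
    then show ?thesis unfolding \<psi>_def pow_eq_iff by (metis zmod)
  qed
  have "?Q \<psi>"
    using \<psi>[of 1] by (auto simp: cyclic_subgroup_eq sym_group_mult \<psi> power_add simp flip: funpow_add)
  then have Q: "?Q (linear_char n c z)"
    unfolding linear_char_def by (rule someI[of ?Q])
  have mem: "c ^^ j \<in> ?H" for j
    unfolding cyclic_subgroup_eq using pos by (intro image_eqI[of _ _ "j mod n"]) (auto simp: pow_eq_iff)
  have z: "z \<noteq> 0" using assms pos by (auto simp: power_0_left)
  have mult: "linear_char n c z (c ^^ a \<circ> c ^^ b) = linear_char n c z (c ^^ a) * linear_char n c z (c ^^ b)" for a b
    using Q mem by (simp add: sym_group_mult)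
  show ?thesis
  proof (induction j)
    case 0
    \<comment> \<open>Since \<open>id \<circ> c = c\<close>, the value at \<open>id\<close> times
      \<open>z\<close> is \<open>z\<close>, and \<open>z\<close> is nonzero.\<close>
    have "linear_char n c z id = 1" using mult[of 0 1] Q z by simp
    then show ?case unfolding funpow.simps power_0 .
  next
    case (Suc j)
    have "linear_char n c z (c \<circ> c ^^ j) = z * z ^ j" using Suc mult[of 1 j] Q by simp
    then show ?case unfolding funpow.simps power_Suc .
  qed
qed

text \<open>Every orbit of \<open>c ^^ j\<close> on \<open>{1..n}\<close> has
  \<open>n div gcd n j\<close> elements, so there are \<open>gcd n j\<close> of them.\<close>

lemma p_cycle_type_pow: "p_cycle_type n (c ^^ j) = sf_p (n div gcd n j) ^ gcd n j"
proof -
  let ?w = "c ^^ j"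
  define d where "d = n div gcd n j"
  have n: "n = d * gcd n j" by (simp add: d_def)
  have dpos: "d > 0" using n pos by (metis gr0I less_one mult_0 not_le)
  have permw: "permutation ?w" using permutes_pow by (auto simp: permutation_permutes)
  \<comment> \<open>Dividing \<open>n\<close> and \<open>j\<close> by their gcd leaves coprime
    numbers, so the return time of \<open>c ^^ j\<close> is exactly \<open>d\<close>.\<close>
  have dvd: "n dvd j * k \<longleftrightarrow> d dvd k" for k
  proof -
    obtain a b where ab: "n = a * gcd n j" "j = b * gcd n j" "coprime a b"
      using gcd_coprime_exists[of n j] pos by auto
    then have "d = a" using n pos by (metis mult_cancel2 mult_0_right not_one_le_zero)
    have "n dvd j * k \<longleftrightarrow> a * gcd n j dvd b * k * gcd n j"
      by (subst (1) ab(1), subst (1) ab(2)) (simp add: mult_ac)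
    also have "\<dots> \<longleftrightarrow> a dvd b * k" using pos by simp
    also have "\<dots> \<longleftrightarrow> a dvd k" using ab(3) by (simp add: coprime_dvd_mult_right_iff)
    finally show ?thesis by (simp add: \<open>d = a\<close>)
  qed
  have pw: "(?w ^^ k) x = (c ^^ (j * k)) x" for k x by (simp add: funpow_mult)
  have card_orbit: "card (orbit ?w x) = d" if x: "x \<in> {1..n}" for x
  proof -
    have wd: "(?w ^^ d) x = x" unfolding pw using pow_eq_self_iff[OF x] dvd by simp
    have "orbit ?w x = (\<lambda>m. (?w ^^ m) x) ` {..<d}"
      using orbit_altdef_bounded[OF wd dpos] by auto
    moreover have "inj_on (\<lambda>m. (?w ^^ m) x) {..<d}"
    proof (rule linorder_inj_onI)
      fix a b assume "a < b" and ab: "a \<in> {..<d}" "b \<in> {..<d}"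
      have "\<not> d dvd b - a" using \<open>a < b\<close> ab by (auto dest: dvd_imp_le)
      moreover have "j * a mod n = j * b mod n \<longleftrightarrow> n dvd j * (b - a)"
        using \<open>a < b\<close> mod_eq_dvd_iff_nat[of "j * a" "j * b" n] by (auto simp: diff_mult_distrib2)
      ultimately show "(?w ^^ a) x \<noteq> (?w ^^ b) x"
        unfolding pw using pow_apply_eq_iff[OF x] dvd by simp
    qed auto
    ultimately show ?thesis by (simp add: card_image)
  qed
  let ?O = "orbit ?w ` {1..n}"
  have sub: "orbit ?w x \<subseteq> {1..n}" if "x \<in> {1..n}" for x
    using permutes_orbit_subset[OF permutes_pow that] .
  have "\<Union> ?O = {1..n}"
    using sub permutation_self_in_orbit[OF permw] by blast
  moreover have "d * card ?O = card (\<Union> ?O)"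
  proof (rule card_partition)
    show "finite (\<Union> ?O)" using \<open>\<Union> ?O = {1..n}\<close> by simp
    fix A B assume AB: "A \<in> ?O" "B \<in> ?O" "A \<noteq> B"
    have "orbit ?w y = orbit ?w x" if "y \<in> orbit ?w x" for x y
      using cyclic_on_orbit'[OF permw] that by (rule orbit_cyclic_eq3)
    then show "A \<inter> B = {}" using AB by blast
  qed (auto simp: card_orbit)
  ultimately have "d * card ?O = d * gcd n j" using n by simp
  then have "card ?O = gcd n j" using dpos by simp
  have "(\<Prod>Z\<in>?O. sf_p (card Z)) = (\<Prod>Z\<in>?O. sf_p d)"
    by (rule prod.cong) (use card_orbit in auto)
  also have "\<dots> = sf_p d ^ gcd n j" using \<open>card ?O = gcd n j\<close> by simp
  finally show ?thesis unfolding p_cycle_type_def d_def .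
qed

end

text \<open>The orbits of the conjugate are the images under \<open>t\<close> of the orbits of
  \<open>w\<close>, with the same sizes.\<close>

lemma p_cycle_type_conj:
  assumes t: "t permutes {1..n}" and w: "w permutes {1..n}"
  shows "p_cycle_type n (t \<circ> w \<circ> inv_into UNIV t) = p_cycle_type n w"
proof -
  let ?v = "t \<circ> w \<circ> inv_into UNIV t"
  have inj: "inj t" using t by (rule permutes_inj)
  have "permutation w" using w by (auto simp: permutation_permutes)
  then have orb: "orbit ?v (t x) = t ` orbit w x" for x
    by (intro orbit_inverse[symmetric] permutation_self_in_orbit) (simp_all add: inv_f_f[OF inj])
  have "orbit ?v ` {1..n} = orbit ?v ` t ` {1..n}" unfolding permutes_image[OF t] ..
  also have "\<dots> = image t ` orbit w ` {1..n}" by (simp add: image_image orb)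
  finally have O: "orbit ?v ` {1..n} = image t ` orbit w ` {1..n}" .
  have "inj_on (image t) A" for A using inj by (auto simp: inj_on_def inj_image_eq_iff)
  then show ?thesis
    unfolding p_cycle_type_def O using inj
    by (subst prod.reindex) (auto simp: card_image inj_on_subset[OF inj])
qed

section \<open>Induced characters\<close>

text \<open>Frobenius reciprocity in summed form: the diagonal entry at a coset with representative
  \<open>t\<close> is supported on the conjugate of \<open>H\<close> by \<open>t\<close>. As
  \<open>p\<close> is invariant under conjugation, conjugating back gives the same sum over
  \<open>H\<close> for every coset.\<close>

lemma sum_induced_character:
  fixes p :: "'a \<Rightarrow> symfun"
  assumes G: "group G" "finite (carrier G)" and H: "subgroup H G"
    and conj: "\<And>t h. t \<in> carrier G \<Longrightarrow> h \<in> carrier G \<Longrightarrow> p (t \<otimes>\<^bsub>G\<^esub> h \<otimes>\<^bsub>G\<^esub> inv\<^bsub>G\<^esub> t) = p h"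
  shows "(\<Sum>g\<in>carrier G. sf_const (induced_character G H \<psi> g) * p g)
    = of_nat (card (lcosets\<^bsub>G\<^esub> H)) * (\<Sum>h\<in>H. sf_const (\<psi> h) * p h)"
proof -
  interpret G: group G by fact
  have Hsub: "H \<subseteq> carrier G" using H by (rule subgroup.subset)
  have "(\<Sum>g\<in>carrier G. sf_const (induced_rep G H \<psi> g A A) * p g) = (\<Sum>h\<in>H. sf_const (\<psi> h) * p h)"
    if A: "A \<in> lcosets\<^bsub>G\<^esub> H" for A
  proof -
    obtain a where a: "a \<in> carrier G" "A = a <#\<^bsub>G\<^esub> H" using A by (auto simp: LCOSETS_def)
    have "a \<in> A" using G.lcos_self[OF a(1) H] a(2) by simp
    then have tA: "coset_rep A \<in> A" unfolding coset_rep_def by (rule someI)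
    define t where "t = coset_rep A"
    have t: "t \<in> carrier G"
      using subgroup.lcosets_carrier[OF H G(1) A] tA by (auto simp: t_def)
    let ?k = "\<lambda>g. inv\<^bsub>G\<^esub> t \<otimes>\<^bsub>G\<^esub> g \<otimes>\<^bsub>G\<^esub> t"
    let ?c = "\<lambda>h. t \<otimes>\<^bsub>G\<^esub> h \<otimes>\<^bsub>G\<^esub> inv\<^bsub>G\<^esub> t"
    have kc: "?k (?c h) = h" "?c (?k h) = h" if "h \<in> carrier G" for h
      using that t by (simp_all add: G.m_assoc[symmetric] G.l_inv G.r_inv)
        (simp_all add: G.m_assoc)
    have "(\<Sum>g\<in>carrier G. sf_const (induced_rep G H \<psi> g A A) * p g)
        = (\<Sum>g\<in>?c ` H. sf_const (\<psi> (?k g)) * p g)"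
    proof (rule sum.mono_neutral_cong_right)
      show "?c ` H \<subseteq> carrier G" using Hsub t by auto
      show "\<forall>g\<in>carrier G - ?c ` H. sf_const (induced_rep G H \<psi> g A A) * p g = 0"
      proof
        fix g assume g: "g \<in> carrier G - ?c ` H"
        then have "?k g \<notin> H" using kc(2)[of g] by (metis DiffE image_eqI)
        then show "sf_const (induced_rep G H \<psi> g A A) * p g = 0"
          by (simp add: induced_rep_def Let_def t_def)
      qed
      fix g assume "g \<in> ?c ` H"
      then obtain h where "h \<in> H" "g = ?c h" by blast
      then have "?k g \<in> H" using kc(1)[of h] Hsub by auto
      then show "sf_const (induced_rep G H \<psi> g A A) * p g = sf_const (\<psi> (?k g)) * p g"
        by (simp add: induced_rep_def Let_def t_def)
    qed (rule G(2))
    also have "\<dots> = (\<Sum>h\<in>H. sf_const (\<psi> (?k (?c h))) * p (?c h))"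
    proof (rule sum.reindex[unfolded o_def])
      show "inj_on ?c H" using kc(1) Hsub by (intro inj_on_inverseI[of _ ?k]) auto
    qed
    also have "\<dots> = (\<Sum>h\<in>H. sf_const (\<psi> h) * p h)"
    proof (rule sum.cong[OF refl])
      fix h assume "h \<in> H"
      then have "h \<in> carrier G" using Hsub by blast
      then show "sf_const (\<psi> (?k (?c h))) * p (?c h) = sf_const (\<psi> h) * p h"
        by (simp only: kc conj[OF t])
    qed
    finally show ?thesis .
  qed
  then have "(\<Sum>A\<in>lcosets\<^bsub>G\<^esub> H. \<Sum>g\<in>carrier G. sf_const (induced_rep G H \<psi> g A A) * p g)
      = of_nat (card (lcosets\<^bsub>G\<^esub> H)) * (\<Sum>h\<in>H. sf_const (\<psi> h) * p h)"
    by simp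
  then show ?thesis
    by (subst (asm) sum.swap) (simp add: induced_character_def sf_const_sum sum_distrib_right)
qed

text \<open>By Lagrange the subgroup has index \<open>n! / n\<close>, which together with the factor
  \<open>n\<close> cancels the normalisation \<open>1 / n!\<close>.\<close>

lemma (in full_cycle) frobenius_induced:
  assumes z: "z ^ n = 1"
  shows "of_nat n * frobenius_characteristic n
      (induced_character (sym_group n) (cyclic_subgroup n c) (linear_char n c z))
    = (\<Sum>j<n. sf_const (z ^ j) * sf_p (n div gcd n j) ^ gcd n j)"
proof -
  let ?G = "sym_group n" and ?H = "cyclic_subgroup n c"
  interpret G: group ?G by (rule sym_group_is_group)
  have H: "subgroup ?H ?G"
    unfolding cyclic_subgroup_def
    by (rule G.generate_is_subgroup)
       (simp only: insert_subset empty_subsetI sym_group_carrier perm simp_thms)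
  have carr: "carrier ?G = {p. p permutes {1..n}}" by (simp add: sym_group_def)
  then have fin: "finite (carrier ?G)" by (simp add: finite_permutations)
  have "card ?H = n" unfolding cyclic_subgroup_eq by (simp add: card_image inj_on_pow)
  moreover have "order ?G = fact n" by (simp add: order_def carr card_permutations)
  ultimately have lag: "card (lcosets\<^bsub>?G\<^esub> ?H) * n = fact n"
    using G.l_lagrange[OF fin H] by simp
  have inv: "inv\<^bsub>?G\<^esub> t = inv_into UNIV t" if "t permutes {1..n}" for t
    using that by (intro G.inv_equality)
      (auto simp: sym_group_mult sym_group_one sym_group_carrier permutes_inv permutes_inv_o)
  have "(\<Sum>g\<in>carrier ?G. sf_const (induced_character ?G ?H (linear_char n c z) g) * p_cycle_type n g)
      = of_nat (card (lcosets\<^bsub>?G\<^esub> ?H)) * (\<Sum>h\<in>?H. sf_const (linear_char n c z h) * p_cycle_type n h)"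
    by (rule sum_induced_character[OF G.group_axioms fin H])
       (simp add: sym_group_carrier sym_group_mult inv p_cycle_type_conj)
  also have "(\<Sum>h\<in>?H. sf_const (linear_char n c z h) * p_cycle_type n h)
      = (\<Sum>j<n. sf_const (z ^ j) * sf_p (n div gcd n j) ^ gcd n j)" (is "_ = ?S")
    unfolding cyclic_subgroup_eq
    by (subst sum.reindex[OF inj_on_pow]) (simp add: linear_char_pow[OF z] p_cycle_type_pow)
  finally have "of_nat n * frobenius_characteristic n (induced_character ?G ?H (linear_char n c z))
      = sf_const (of_nat n * (1 / fact n) * of_nat (card (lcosets\<^bsub>?G\<^esub> ?H))) * ?S"
    unfolding frobenius_characteristic_def by (simp only: sf_const_mult sf_const_of_nat mult.assoc)
  also have "of_nat n * (1 / fact n) * of_nat (card (lcosets\<^bsub>?G\<^esub> ?H)) = (1 :: complex)"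
  proof -
    have "of_nat (card (lcosets\<^bsub>?G\<^esub> ?H)) * of_nat n = (fact n :: complex)"
      using lag by (metis of_nat_fact of_nat_mult)
    then show ?thesis by (simp add: field_simps)
  qed
  finally show ?thesis by simp
qed

section \<open>The character sums of \<open>Lie\<^sub>n\<^sup>S\<close>\<close>

lemma P_set_dvd: "a \<in> P_set S \<Longrightarrow> b dvd a \<Longrightarrow> b \<in> P_set S"
  by (auto simp: P_set_def intro: dvd_trans dest: dvd_pos_nat)

text \<open>\<open>P(S)\<close> is closed under divisors and least common multiples, so the largest
  divisor of \<open>n\<close> in \<open>P(S)\<close> is a multiple of all the others.\<close>

lemma dvd_Q_part_iff:
  assumes "n > 0" "d dvd n"
  shows "d dvd Q_part S n \<longleftrightarrow> d \<in> P_set S"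
proof -
  let ?D = "{d. d dvd n \<and> d \<in> P_set S}"
  have fin: "finite ?D" using assms(1) by simp
  have "1 \<in> ?D" by (auto simp: P_set_def)
  then have Q: "Q_part S n \<in> ?D" unfolding Q_part_def using fin by (intro Max_in) auto
  show ?thesis
  proof
    assume "d \<in> P_set S"
    have "lcm d (Q_part S n) \<in> P_set S"
    proof -
      have "p \<in> S" if "prime p" "p dvd lcm d (Q_part S n)" for p
      proof -
        have "lcm d (Q_part S n) dvd d * Q_part S n" by (rule lcm_least) auto
        with that(2) have "p dvd d * Q_part S n" by (rule dvd_trans)
        then show ?thesis using that(1) \<open>d \<in> P_set S\<close> Q by (auto simp: P_set_def prime_dvd_mult_iff)
      qed
      then show ?thesis using \<open>d \<in> P_set S\<close> Q by (auto simp: P_set_def lcm_pos_nat)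
    qed
    then have "lcm d (Q_part S n) \<in> ?D" using assms(2) Q by simp
    then have "lcm d (Q_part S n) \<le> Q_part S n" unfolding Q_part_def[of S n] using fin by (intro Max_ge) auto
    moreover have "Q_part S n \<le> lcm d (Q_part S n)"
      using \<open>lcm d (Q_part S n) \<in> P_set S\<close> by (intro dvd_imp_le) (auto simp: P_set_def)
    ultimately have "lcm d (Q_part S n) = Q_part S n" by simp
    then show "d dvd Q_part S n" by (metis dvd_lcm1)
  qed (use Q P_set_dvd in blast)
qed

text \<open>The sum of the values of the inducing character of \<open>C\<^sub>n\<close> at the elements of order \<open>d\<close>.\<close>

definition order_sum :: "nat set \<Rightarrow> nat \<Rightarrow> nat \<Rightarrow> complex" where
  "order_sum S n d = (\<Sum>j | j < n \<and> n div gcd n j = d.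
     exp (2 * of_real pi * \<i> / of_nat n * of_nat (Q_part S n)) ^ j)"

lemma root_of_unity_sum:
  assumes "n > 0" "w ^ n = (1 :: complex)"
  shows "(\<Sum>j<n. w ^ j) = (if w = 1 then of_nat n else 0)"
  using assms by (simp add: sum_gp_strict)

text \<open>The \<open>j\<close>th power of the cycle has order \<open>n div gcd n j\<close>, which
  divides \<open>D\<close> iff \<open>r = n / D\<close> divides \<open>j\<close>. On this subgroup
  of order \<open>D\<close> the character takes the powers of \<open>exp(2 pi i Q / D)\<close>;
  their sum vanishes unless this root of unity is 1, that is, unless \<open>D\<close> divides
  \<open>Q\<close>.\<close>

lemma sum_order_sum:
  assumes n: "n > 0" and D: "D dvd n"
  shows "(\<Sum>d | d dvd D. order_sum S n d) = (if D \<in> P_set S then of_nat D else 0)"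
proof -
  define Q where "Q = Q_part S n"
  define z where "z = exp (2 * of_real pi * \<i> / of_nat n * of_nat Q)"
  obtain r where r: "n = r * D" using D by (metis dvdE mult.commute)
  have rD: "r > 0" "D > 0" using n r by auto
  have iff: "n div gcd n j dvd D \<longleftrightarrow> r dvd j" for j
  proof -
    have "n div gcd n j dvd D \<longleftrightarrow> n dvd D * gcd n j"
      using n by (metis dvd_div_iff_mult gcd_dvd1 gcd_eq_0_iff less_numeral_extra(3) mult.commute dvd_div_mult_self dvd_times_right_cancel_iff)
    also have "\<dots> \<longleftrightarrow> r dvd gcd n j" using rD unfolding r by (simp add: mult.commute)
    also have "\<dots> \<longleftrightarrow> r dvd j" by (simp add: r)
    finally show ?thesis .
  qed
  have finD: "finite {d. d dvd D}" using rD by simp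
  have "(\<Sum>d | d dvd D. order_sum S n d) = (\<Sum>d\<in>{d. d dvd D}. \<Sum>j\<in>{j \<in> {j. j < n \<and> r dvd j}. n div gcd n j = d}. z ^ j)"
    unfolding order_sum_def z_def Q_def by (intro sum.cong refl) (auto simp: iff)
  also have "\<dots> = (\<Sum>j | j < n \<and> r dvd j. z ^ j)"
    by (rule sum.group) (use finD in \<open>auto simp: iff\<close>)
  also have "\<dots> = (\<Sum>i<D. (z ^ r) ^ i)"
    by (rule sum.reindex_bij_witness[where i = "\<lambda>i. r * i" and j = "\<lambda>j. j div r"])
       (use rD in \<open>auto simp: r less_mult_imp_div_less mult.commute[of r] simp flip: power_mult\<close>)
  also have "z ^ r = exp (2 * of_real pi * \<i> * of_nat Q / of_nat D)"
    using rD by (simp add: z_def exp_of_nat_mult[symmetric] r field_simps)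
  also have "(\<Sum>i<D. exp (2 * of_real pi * \<i> * of_nat Q / of_nat D) ^ i) = (if D dvd Q then of_nat D else 0)"
    using rD root_of_unity_sum[OF rD(2) complex_root_unity[of D Q]] complex_root_unity_eq_1[of D Q] by simp
  also have "D dvd Q \<longleftrightarrow> D \<in> P_set S" using dvd_Q_part_iff[OF n D] by (simp add: Q_def)
  finally show ?thesis .
qed

text \<open>The sums over all divisors of \<open>d\<close> are the same for \<open>n\<close> and for
  \<open>d\<close>. By induction the terms at proper divisors agree, hence so do the terms at
  \<open>d\<close>.\<close>

lemma order_sum_eq:
  assumes "n > 0" "d dvd n"
  shows "order_sum S n d = order_sum S d d"
  using assms
proof (induction d arbitrary: n rule: less_induct)
  case (less d)
  have d: "d > 0" using less.prems by (simp add: dvd_pos_nat)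
  have split: "(\<Sum>e | e dvd d. F e) = F d + (\<Sum>e | e dvd d \<and> e \<noteq> d. F e)" for F :: "nat \<Rightarrow> complex"
  proof -
    have "{e. e dvd d} - {d} = {e. e dvd d \<and> e \<noteq> d}" by auto
    then show ?thesis using d by (subst sum.remove[of _ d]) auto
  qed
  have *: "order_sum S n e = order_sum S d e" if "e dvd d \<and> e \<noteq> d" for e
  proof -
    have "e < d" using that d by (auto dest: dvd_imp_le)
    then show ?thesis
      using less.IH[of e n] less.IH[of e d] that less.prems d dvd_trans by metis
  qed
  show ?case
    using sum_order_sum[OF less.prems, of S] sum_order_sum[OF d dvd_refl, of S]
    by (simp add: split *) (metis add_right_cancel)
qed

lemma sum_order_sum_diag:
  assumes "D > 0"
  shows "(\<Sum>d | d dvd D. order_sum S d d) = (if D \<in> P_set S then of_nat D else 0)"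
proof -
  have "(\<Sum>d | d dvd D. order_sum S d d) = (\<Sum>d | d dvd D. order_sum S D d)"
    using order_sum_eq[OF assms, of _ S] by simp
  then show ?thesis using sum_order_sum[OF assms dvd_refl] by simp
qed

text \<open>The powers of the cycle are grouped by their order \<open>d\<close>;
  \<open>order_sum_eq\<close> then frees the coefficients from \<open>n\<close>.\<close>

lemma Lie_S_expansion:
  assumes "n \<ge> 1" "n_cycle n (c n)"
  shows "of_nat n * Lie_S S c n = (\<Sum>d | d dvd n. sf_const (order_sum S d d) * sf_p d ^ (n div d))"
proof -
  interpret full_cycle n "c n" by unfold_locales fact+
  define z where "z = exp (2 * of_real pi * \<i> / of_nat n * of_nat (Q_part S n))"
  have "z ^ n = 1"
    using complex_root_unity[of n "Q_part S n"] assms(1) by (simp add: z_def)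
  then have "of_nat n * Lie_S S c n = (\<Sum>j<n. sf_const (z ^ j) * sf_p (n div gcd n j) ^ gcd n j)"
    unfolding Lie_S_def z_def[symmetric] by (rule frobenius_induced)
  also have "\<dots> = (\<Sum>d | d dvd n. \<Sum>j | j \<in> {..<n} \<and> n div gcd n j = d.
      sf_const (z ^ j) * sf_p (n div gcd n j) ^ gcd n j)"
  proof (rule sum.group[symmetric])
    have "n div gcd n j dvd n" for j by (metis dvd_div_mult_self dvd_triv_left gcd_dvd1)
    then show "(\<lambda>j. n div gcd n j) ` {..<n} \<subseteq> {d. d dvd n}" by blast
  qed (use assms in auto)
  also have "\<dots> = (\<Sum>d | d dvd n. sf_const (order_sum S n d) * sf_p d ^ (n div d))"
  proof (rule sum.cong[OF refl])
    fix d assume "d \<in> {d. d dvd n}"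
    have "sf_const (z ^ j) * sf_p (n div gcd n j) ^ gcd n j = sf_const (z ^ j) * sf_p d ^ (n div d)"
      if "j < n \<and> n div gcd n j = d" for j
    proof -
      have "n = d * gcd n j" using that by auto
      then have "n div d = gcd n j" using assms(1) by (metis mult_0 nonzero_mult_div_cancel_left not_one_le_zero)
      then show ?thesis using that by simp
    qed
    moreover have "order_sum S n d = (\<Sum>j | j < n \<and> n div gcd n j = d. z ^ j)"
      by (simp only: order_sum_def z_def)
    ultimately show "(\<Sum>j | j \<in> {..<n} \<and> n div gcd n j = d. sf_const (z ^ j) * sf_p (n div gcd n j) ^ gcd n j)
        = sf_const (order_sum S n d) * sf_p d ^ (n div d)"
      by (simp add: sf_const_sum sum_distrib_right)
  qed
  also have "\<dots> = (\<Sum>d | d dvd n. sf_const (order_sum S d d) * sf_p d ^ (n div d))"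
    using order_sum_eq[of n _ S] assms(1) by (intro sum.cong) auto
  finally show ?thesis .
qed

section \<open>The logarithmic derivatives of both sides\<close>

text \<open>The series of all \<open>g D r * p_D^r * t^(D r)\<close> with positive \<open>D\<close>
  and \<open>r\<close>, the common form in which the logarithmic derivatives of both sides are
  compared.\<close>

definition pow_sum_log :: "(nat \<Rightarrow> nat \<Rightarrow> symfun) \<Rightarrow> symfun fps" where
  "pow_sum_log g = Abs_fps (\<lambda>N. if N = 0 then 0 else \<Sum>(D, r)\<in>divpairs N. g D r * sf_p D ^ r)"

lemma sum_divpairs_fst:
  assumes "N > 0"
  shows "(\<Sum>(D, r)\<in>divpairs N. F D r) = (\<Sum>D | D dvd N. F D (N div D))"
  by (rule sum.reindex_bij_witness[where i = "\<lambda>D. (D, N div D)" and j = fst])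
     (use assms in \<open>auto simp: divpairs_def\<close>)

text \<open>Both sides run over the triples \<open>(d, k, r)\<close> with product \<open>N\<close>,
  bracketed once as \<open>(d r) k\<close> and once as \<open>(d k) r\<close>.\<close>

lemma sum_divpairs_assoc:
  assumes "N > 0"
  shows "(\<Sum>(i, k)\<in>divpairs N. \<Sum>(d, r)\<in>divpairs i. F d k r)
    = (\<Sum>(D, r)\<in>divpairs N. \<Sum>(d, k)\<in>divpairs D. F d k r)"
proof -
  have fin: "finite (divpairs (fst x))" if "x \<in> divpairs N" for x
    using that assms by (intro finite_divpairs) (auto simp: divpairs_def intro!: gr0I)
  have "(\<Sum>x\<in>divpairs N. \<Sum>y\<in>divpairs (fst x). F (fst y) (snd x) (snd y))
      = (\<Sum>(x, y)\<in>Sigma (divpairs N) (\<lambda>x. divpairs (fst x)). F (fst y) (snd x) (snd y))"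
    using assms fin by (subst sum.Sigma) auto
  also have "\<dots> = (\<Sum>(x, y)\<in>Sigma (divpairs N) (\<lambda>x. divpairs (fst x)). F (fst y) (snd y) (snd x))"
    by (rule sum.reindex_bij_witness
        [where i = "\<lambda>((D, r), (d, k)). ((d * r, k), (d, r))" and j = "\<lambda>((i, k), (d, r)). ((d * k, r), (d, k))"])
       (auto simp: divpairs_def mult_ac)
  also have "\<dots> = (\<Sum>x\<in>divpairs N. \<Sum>y\<in>divpairs (fst x). F (fst y) (snd y) (snd x))"
    using assms fin by (subst sum.Sigma) auto
  finally show ?thesis by (simp add: split_def)
qed

lemma pow_sum_log_cong:
  assumes "\<And>D r. D > 0 \<Longrightarrow> r > 0 \<Longrightarrow> g D r = h D r"
  shows "pow_sum_log g = pow_sum_log h"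
proof (rule fps_ext)
  fix N
  have "(\<Sum>x\<in>divpairs N. g (fst x) (snd x) * sf_p (fst x) ^ snd x)
      = (\<Sum>x\<in>divpairs N. h (fst x) (snd x) * sf_p (fst x) ^ snd x)" if "N > 0"
    by (rule sum.cong[OF refl]) (use assms that in \<open>auto simp: divpairs_def intro!: gr0I\<close>)
  then show "fps_nth (pow_sum_log g) N = fps_nth (pow_sum_log h) N"
    by (simp add: pow_sum_log_def split_def)
qed

lemma pow_sum_log_add: "pow_sum_log g + pow_sum_log h = pow_sum_log (\<lambda>D r. g D r + h D r)"
  by (rule fps_ext) (simp add: pow_sum_log_def split_def sum.distrib distrib_right)

lemma omega_pow_sum_log:
  assumes "\<And>D r. omega (g D r) = g D r"
  shows "omega_series (pow_sum_log g) = pow_sum_log (\<lambda>D r. g D r * (-1) ^ ((D - 1) * r))"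
proof (rule fps_ext)
  fix N
  note hom = sf_alg_homD[OF omega_props(1)]
  have "(\<Sum>x\<in>divpairs N. omega (g (fst x) (snd x) * sf_p (fst x) ^ snd x))
      = (\<Sum>x\<in>divpairs N. g (fst x) (snd x) * (-1) ^ ((fst x - 1) * snd x) * sf_p (fst x) ^ snd x)"
    if "N > 0"
  proof (rule sum.cong[OF refl])
    fix x assume "x \<in> divpairs N"
    then have "fst x \<ge> 1" using that by (auto simp: divpairs_def Suc_le_eq intro!: gr0I)
    then show "omega (g (fst x) (snd x) * sf_p (fst x) ^ snd x)
        = g (fst x) (snd x) * (-1) ^ ((fst x - 1) * snd x) * sf_p (fst x) ^ snd x"
      by (simp only: hom assms omega_props(2) power_mult_distrib power_mult mult.assoc)
  qed
  then show "fps_nth (omega_series (pow_sum_log g)) N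
      = fps_nth (pow_sum_log (\<lambda>D r. g D r * (-1) ^ ((D - 1) * r))) N"
    by (simp add: omega_series_def pow_sum_log_def split_def hom)
qed

section \<open>Logarithmic derivatives of the products\<close>

definition factor_log :: "nat \<Rightarrow> (nat \<Rightarrow> symfun) \<Rightarrow> symfun fps" where
  "factor_log n g = Abs_fps (\<lambda>k. if k > 0 \<and> n dvd k then g (k div n) * sf_p n ^ (k div n) else 0)"

text \<open>The geometric series for \<open>1 - a t^n\<close> is used with \<open>a = p_n\<close>
  and \<open>a = - p_n\<close>; passing to the inverse changes the sign.\<close>

lemma log_deriv_factors:
  assumes "n > 0"
  shows "log_deriv (1 - tp n) (factor_log n (\<lambda>r. - of_nat n))"
    and "log_deriv (unit_inv (1 - tp n)) (factor_log n (\<lambda>r. of_nat n))"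
    and "log_deriv (1 + tp n) (factor_log n (\<lambda>r. - of_nat n * (-1) ^ r))"
    and "log_deriv (unit_inv (1 + tp n)) (factor_log n (\<lambda>r. of_nat n * (-1) ^ r))"
proof -
  show *: "log_deriv (1 - tp n) (factor_log n (\<lambda>r. - of_nat n))"
    using log_deriv_one_minus[OF assms, of "sf_p n"] by (simp add: tp_def factor_log_def)
  have "1 - fps_X ^ n * fps_const (- sf_p n) = 1 + tp n"
    by (simp add: tp_def fps_const_neg[symmetric] del: fps_const_neg)
  moreover have "(\<lambda>k. if k > 0 \<and> n dvd k then - of_nat n * (- sf_p n) ^ (k div n) else 0)
      = (\<lambda>k. if k > 0 \<and> n dvd k then - of_nat n * (-1) ^ (k div n) * sf_p n ^ (k div n) else 0)"
    by (rule ext) (simp add: power_minus[of "sf_p n"])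
  ultimately show **: "log_deriv (1 + tp n) (factor_log n (\<lambda>r. - of_nat n * (-1) ^ r))"
    using log_deriv_one_minus[OF assms, of "- sf_p n"] unfolding factor_log_def by (simp only:)
  have neg: "- factor_log n g = factor_log n (\<lambda>r. - g r)" for g
    by (rule fps_ext) (simp add: factor_log_def)
  show "log_deriv (unit_inv (1 - tp n)) (factor_log n (\<lambda>r. of_nat n))"
    using log_deriv_unit_inv[OF *] by (simp add: neg)
  show "log_deriv (unit_inv (1 + tp n)) (factor_log n (\<lambda>r. of_nat n * (-1) ^ r))"
    using log_deriv_unit_inv[OF **] by (simp add: neg)
qed

text \<open>The factor at \<open>D\<close> contributes to the coefficient of \<open>t^N\<close> only
  if \<open>D\<close> divides \<open>N\<close>, and then through \<open>p_D^(N/D)\<close>.\<close>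

lemma log_deriv_prod_over_factors:
  assumes pos: "\<And>n. n \<in> A \<Longrightarrow> n > 0"
    and ld: "\<And>n. n > 0 \<Longrightarrow> log_deriv (f n) (factor_log n (g n))"
  shows "log_deriv (prod_over A f) (pow_sum_log (\<lambda>D r. if D \<in> A then g D r else 0))"
proof -
  have "log_deriv (prod_over A f) (Abs_fps (\<lambda>k. \<Sum>n\<in>A \<inter> {..k}. fps_nth (factor_log n (g n)) k))"
  proof (rule log_deriv_prod_over)
    show "log_deriv (f n) (factor_log n (g n))" if "n \<in> A" for n using that by (intro ld pos)
    show "fps_nth (factor_log n (g n)) k = 0" if "n \<in> A" "k < n" for n k
      using that by (auto simp: factor_log_def dest: dvd_imp_le)
  qed (rule pos)
  also have "Abs_fps (\<lambda>k. \<Sum>n\<in>A \<inter> {..k}. fps_nth (factor_log n (g n)) k)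
      = pow_sum_log (\<lambda>D r. if D \<in> A then g D r else 0)"
  proof (rule fps_ext)
    fix N
    show "fps_nth (Abs_fps (\<lambda>k. \<Sum>n\<in>A \<inter> {..k}. fps_nth (factor_log n (g n)) k)) N
        = fps_nth (pow_sum_log (\<lambda>D r. if D \<in> A then g D r else 0)) N"
    proof (cases "N = 0")
      case True
      then show ?thesis by (simp add: pow_sum_log_def factor_log_def)
    next
      case False
      then have "(\<Sum>n\<in>A \<inter> {..N}. fps_nth (factor_log n (g n)) N)
          = (\<Sum>D | D dvd N. (if D \<in> A then g D (N div D) else 0) * sf_p D ^ (N div D))"
        by (intro sum.mono_neutral_cong) (auto simp: factor_log_def dest: dvd_imp_le)
      then show ?thesis using False by (simp add: pow_sum_log_def sum_divpairs_fst)
    qed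
  qed
  finally show ?thesis .
qed

section \<open>Alternating sums of the character sums\<close>

text \<open>This becomes the coefficient of \<open>p_D^r\<close> in the logarithmic derivative of
  \<open>E[Lie^S]\<close>, for every \<open>r\<close>; the index \<open>k\<close> comes from
  \<open>p_k[p_d] = p_D\<close>.\<close>

definition signed_sum :: "nat set \<Rightarrow> nat \<Rightarrow> symfun" where
  "signed_sum S D = (\<Sum>(d, k)\<in>divpairs D. (-1) ^ (k - 1) * sf_const (order_sum S d d))"

text \<open>The sign \<open>(-1)^(k-1)\<close> is 1, minus 2 if \<open>k\<close> is even. The
  unsigned part is the divisor sum for \<open>D\<close>. The pairs with even \<open>k\<close>
  correspond to the factorizations of \<open>D/2\<close>, whose divisor sum, \<open>D/2\<close> or
  0, is doubled.\<close>

lemma signed_sum_eq: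
  assumes "D > 0"
  shows "signed_sum S D = (if D \<in> P_set S then of_nat D else 0)
    - (if even D \<and> D div 2 \<in> P_set S then of_nat D else 0)"
proof -
  define f where "f d = sf_const (order_sum S d d)" for d
  have F: "(\<Sum>(d, k)\<in>divpairs D. f d) = (if D \<in> P_set S then of_nat D else 0)" if "D > 0" for D
    using sum_order_sum_diag[OF that, of S] sum_divpairs_fst[OF that, of "\<lambda>d k. f d"]
    by (simp add: f_def sf_const_of_nat flip: sf_const_sum)
  have "signed_sum S D = (\<Sum>x\<in>divpairs D. f (fst x) - (if even (snd x) then 2 * f (fst x) else 0))"
    unfolding signed_sum_def f_def split_def
  proof (rule sum.cong[OF refl])
    fix x assume "x \<in> divpairs D"
    then have "snd x > 0" using assms by (auto simp: divpairs_def intro!: gr0I)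
    then show "(-1) ^ (snd x - 1) * sf_const (order_sum S (fst x) (fst x))
        = sf_const (order_sum S (fst x) (fst x))
          - (if even (snd x) then 2 * sf_const (order_sum S (fst x) (fst x)) else 0)"
      by (cases "snd x") auto
  qed
  also have "\<dots> = (\<Sum>(d, k)\<in>divpairs D. f d) - (\<Sum>x\<in>divpairs D. if even (snd x) then 2 * f (fst x) else 0)"
    by (simp add: sum_subtractf split_def)
  also have "(\<Sum>x\<in>divpairs D. if even (snd x) then 2 * f (fst x) else 0)
      = (\<Sum>x | x \<in> divpairs D \<and> even (snd x). 2 * f (fst x))"
    using assms by (simp add: sum.inter_filter)
  also have "\<dots> = (if even D \<and> D div 2 \<in> P_set S then of_nat D else 0)"
  proof (cases "even D")
    case False
    then have *: "{x. x \<in> divpairs D \<and> even (snd x)} = {}" by (auto simp: divpairs_def)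
    show ?thesis unfolding * using False by simp
  next
    case True
    then obtain E where E: "D = 2 * E" by blast
    have "(\<Sum>x | x \<in> divpairs D \<and> even (snd x). 2 * f (fst x)) = (\<Sum>x\<in>divpairs E. 2 * f (fst x))"
      by (rule sum.reindex_bij_witness[where i = "\<lambda>x. (fst x, 2 * snd x)" and j = "\<lambda>x. (fst x, snd x div 2)"])
         (auto simp: divpairs_def E)
    also have "\<dots> = 2 * (\<Sum>(d, k)\<in>divpairs E. f d)" by (simp add: sum_distrib_left split_def)
    finally show ?thesis using assms by (simp add: E F)
  qed
  finally show ?thesis using F[OF assms] by simp
qed

lemma omega_signed_sum: "omega (signed_sum S D) = signed_sum S D"
  unfolding signed_sum_def split_def by (simp add: sf_alg_homD[OF omega_props(1)])

section \<open>The series of the modules \<open>Lie\<^sub>n\<^sup>S\<close>\<close>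

text \<open>The terms \<open>p_k[p_d] = p_(dk)\<close> are regrouped by \<open>D = d k\<close>. The
  weight \<open>s\<close> allows for both uses: it is 1 for \<open>Lie_S\<close> and a sign for
  \<open>omega_alt\<close>.\<close>

lemma E_log_coeff_expansion:
  assumes "\<And>i k. i \<ge> 1 \<Longrightarrow> k \<ge> 1 \<Longrightarrow> of_nat i * sf_subst_power k (q i)
      = (\<Sum>(d, r)\<in>divpairs i. sf_const (order_sum S d d) * s r * sf_p (d * k) ^ r)"
  shows "Abs_fps (E_log_coeff q) = pow_sum_log (\<lambda>D r. signed_sum S D * s r)"
proof (rule fps_ext)
  fix N
  show "fps_nth (Abs_fps (E_log_coeff q)) N = fps_nth (pow_sum_log (\<lambda>D r. signed_sum S D * s r)) N"
  proof (cases "N = 0")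
    case True
    then show ?thesis by (simp add: E_log_coeff_def pow_sum_log_def)
  next
    case False
    let ?f = "\<lambda>d. sf_const (order_sum S d d)"
    have "E_log_coeff q N = (\<Sum>x\<in>divpairs N. (-1) ^ (snd x - 1) * (of_nat (fst x) * sf_subst_power (snd x) (q (fst x))))"
      using False by (simp add: E_log_coeff_def split_def mult.left_commute)
    also have "\<dots> = (\<Sum>x\<in>divpairs N. \<Sum>y\<in>divpairs (fst x).
        (-1) ^ (snd x - 1) * (?f (fst y) * s (snd y) * sf_p (fst y * snd x) ^ snd y))"
    proof (rule sum.cong[OF refl])
      fix x assume "x \<in> divpairs N"
      then have x: "fst x \<ge> 1" "snd x \<ge> 1" using False by (auto simp: divpairs_def Suc_le_eq intro!: gr0I)
      show "(-1) ^ (snd x - 1) * (of_nat (fst x) * sf_subst_power (snd x) (q (fst x)))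
          = (\<Sum>y\<in>divpairs (fst x). (-1) ^ (snd x - 1) * (?f (fst y) * s (snd y) * sf_p (fst y * snd x) ^ snd y))"
        unfolding assms[OF x] by (simp only: sum_distrib_left split_def)
    qed
    also have "\<dots> = (\<Sum>x\<in>divpairs N. \<Sum>y\<in>divpairs (fst x).
        (-1) ^ (snd y - 1) * (?f (fst y) * s (snd x) * sf_p (fst y * snd y) ^ snd x))"
      using sum_divpairs_assoc[of N "\<lambda>d k r. (-1) ^ (k - 1) * (?f d * s r * sf_p (d * k) ^ r)"] False
      by (simp only: split_def)
    also have "\<dots> = (\<Sum>x\<in>divpairs N. signed_sum S (fst x) * s (snd x) * sf_p (fst x) ^ snd x)"
    proof (rule sum.cong[OF refl])
      fix x :: "nat \<times> nat"
      have "fst y * snd y = fst x" if "y \<in> divpairs (fst x)" for y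
        using that by (auto simp: divpairs_def)
      then show "(\<Sum>y\<in>divpairs (fst x). (-1) ^ (snd y - 1) * (?f (fst y) * s (snd x) * sf_p (fst y * snd y) ^ snd x))
          = signed_sum S (fst x) * s (snd x) * sf_p (fst x) ^ snd x"
        by (simp add: signed_sum_def split_def sum_distrib_right mult.assoc cong: sum.cong_simp)
    qed
    finally show ?thesis using False by (simp add: pow_sum_log_def split_def)
  qed
qed

context
  fixes S :: "nat set" and c :: "nat \<Rightarrow> nat \<Rightarrow> nat"
  assumes c: "\<And>n. n \<ge> 1 \<Longrightarrow> n_cycle n (c n)"
begin

lemma Lie_S_divpairs:
  assumes "i \<ge> 1"
  shows "of_nat i * Lie_S S c i = (\<Sum>(d, r)\<in>divpairs i. sf_const (order_sum S d d) * sf_p d ^ r)"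
  using assms sum_divpairs_fst[of i "\<lambda>d r. sf_const (order_sum S d d) * sf_p d ^ r"]
  by (simp add: Lie_S_expansion[of i c, OF assms c[OF assms]])

lemma log_deriv_E_Lie:
  "log_deriv (E_series (Lie_S S c)) (pow_sum_log (\<lambda>D r. signed_sum S D))"
proof -
  have "Abs_fps (E_log_coeff (Lie_S S c)) = pow_sum_log (\<lambda>D r. signed_sum S D * 1)"
  proof (rule E_log_coeff_expansion)
    fix i k :: nat assume ik: "i \<ge> 1" "k \<ge> 1"
    note hom = sf_alg_homD[OF sf_alg_hom_subst_power[OF ik(2)]]
    have "of_nat i * sf_subst_power k (Lie_S S c i) = sf_subst_power k (of_nat i * Lie_S S c i)"
      by (simp only: hom)
    also have "\<dots> = (\<Sum>(d, r)\<in>divpairs i. sf_const (order_sum S d d) * 1 * sf_p (d * k) ^ r)"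
      unfolding Lie_S_divpairs[OF ik(1)] hom
      by (simp add: split_def hom sf_subst_power_p[OF ik(2)] mult.commute)
    finally show "of_nat i * sf_subst_power k (Lie_S S c i) = \<dots>" .
  qed
  then show ?thesis using log_deriv_E_series[of "Lie_S S c"] by simp
qed

lemma log_deriv_E_omega_alt:
  "log_deriv (E_series (omega_alt (Lie_S S c))) (pow_sum_log (\<lambda>D r. signed_sum S D * (-1) ^ (r - 1)))"
proof -
  let ?f = "\<lambda>d. sf_const (order_sum S d d)"
  have "Abs_fps (E_log_coeff (omega_alt (Lie_S S c))) = pow_sum_log (\<lambda>D r. signed_sum S D * (-1) ^ (r - 1))"
  proof (rule E_log_coeff_expansion)
    fix i k :: nat assume ik: "i \<ge> 1" "k \<ge> 1"
    note om = sf_alg_homD[OF omega_props(1)]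
    note hom = sf_alg_homD[OF sf_alg_hom_subst_power[OF ik(2)]]
    have "of_nat i * sf_subst_power k (omega_alt (Lie_S S c) i)
        = sf_subst_power k ((-1) ^ (i - 1) * omega (of_nat i * Lie_S S c i))"
      unfolding omega_alt_def by (simp add: hom om mult.left_commute)
    also have "(-1) ^ (i - 1) * omega (of_nat i * Lie_S S c i)
        = (\<Sum>y\<in>divpairs i. ?f (fst y) * (-1) ^ (snd y - 1) * sf_p (fst y) ^ snd y)"
      unfolding Lie_S_divpairs[OF ik(1)] om split_def sum_distrib_left
    proof (rule sum.cong[OF refl])
      fix y assume "y \<in> divpairs i"
      then obtain d r where y: "y = (d, r)" "i = d * r" by (auto simp: divpairs_def)
      then have pos: "d \<ge> 1" "r \<ge> 1" using ik by (auto simp: Suc_le_eq intro!: gr0I)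
      \<comment> \<open>With \<open>i = d r\<close>, the exponent \<open>d r - 1 + (d - 1) r\<close>
        has the parity of \<open>r - 1\<close>.\<close>
      have ev: "even (i - 1 + (d - 1) * r) \<longleftrightarrow> even (r - 1)"
        using pos by (cases d; cases r) (auto simp: y(2))
      have "(-1) ^ (i - 1) * ((-1) ^ (d - 1)) ^ r = ((-1) ^ (i - 1 + (d - 1) * r) :: symfun)"
        by (simp only: power_add power_mult)
      also have "\<dots> = (-1) ^ (r - 1)" by (simp only: minus_one_power_iff ev)
      finally have sgn: "(-1) ^ (i - 1) * ((-1) ^ (d - 1)) ^ r = ((-1) ^ (r - 1) :: symfun)" .
      have "(-1) ^ (i - 1) * (?f d * omega (sf_p d) ^ r)
          = ?f d * ((-1) ^ (i - 1) * ((-1) ^ (d - 1)) ^ r) * sf_p d ^ r"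
        by (simp add: omega_props(2)[OF pos(1)] power_mult_distrib mult_ac)
      then show "(-1) ^ (i - 1) * (?f (fst y) * omega (sf_p (fst y)) ^ snd y)
          = ?f (fst y) * (-1) ^ (snd y - 1) * sf_p (fst y) ^ snd y"
        unfolding sgn y(1) fst_conv snd_conv by (simp only:)
    qed
    also have "sf_subst_power k \<dots> = (\<Sum>(d, r)\<in>divpairs i. ?f d * (-1) ^ (r - 1) * sf_p (d * k) ^ r)"
      by (simp add: split_def hom sf_subst_power_p[OF ik(2)] mult.commute[of k])
    finally show "of_nat i * sf_subst_power k (omega_alt (Lie_S S c) i) = \<dots>" .
  qed
  then show ?thesis using log_deriv_E_series[of "omega_alt (Lie_S S c)"] by simp
qed

end

lemma log_deriv_unique_pow_sum_log:
  assumes "log_deriv F (pow_sum_log g)" "log_deriv G (pow_sum_log h)"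
    and "\<And>D r. D > 0 \<Longrightarrow> r > 0 \<Longrightarrow> g D r = h D r"
  shows "F = G"
proof -
  have "pow_sum_log g = pow_sum_log h" using assms(3) by (rule pow_sum_log_cong)
  then have "log_deriv G (pow_sum_log g)" using assms(2) by simp
  with assms(1) show ?thesis by (rule log_deriv_unique)
qed

text \<open>A further factor 2 brings in no prime outside \<open>S\<close>. For
  \<open>2 \<in> S\<close> this makes the two terms of \<open>signed_sum_eq\<close> cancel at every
  even \<open>D\<close>, so that only odd indices survive.\<close>

lemma P_set_even_iff:
  assumes "2 \<in> S" "even D" "D > 0"
  shows "D \<in> P_set S \<longleftrightarrow> D div 2 \<in> P_set S"
proof -
  obtain E where E: "D = 2 * E" using assms(2) by blast
  have "p dvd D \<longleftrightarrow> p = 2 \<or> p dvd E" if "prime p" for p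
    using that by (auto simp: E prime_dvd_mult_iff primes_dvd_imp_eq two_is_prime_nat)
  then show ?thesis using assms by (auto simp: P_set_def E two_is_prime_nat)
qed

theorem theorem3p9:
  fixes S :: "nat set" and c :: "nat \<Rightarrow> nat \<Rightarrow> nat"
  assumes "\<And>p. p \<in> S \<Longrightarrow> prime p"
    and "\<And>n. n \<ge> 1 \<Longrightarrow> n_cycle n (c n)"
  shows
    "(2 \<notin> S \<longrightarrow>
        E_series (Lie_S S c) =
          prod_over (P_set S) (\<lambda>n. unit_inv (1 - tp n))
          * prod_over {n. even n \<and> n div 2 \<in> P_set S} (\<lambda>n. 1 - tp n))
   \<and> (2 \<in> S \<longrightarrow>
        E_series (Lie_S S c) =
          prod_over {n. odd n \<and> n \<in> P_set S} (\<lambda>n. unit_inv (1 - tp n))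
      \<and> prod_over {n. odd n \<and> n \<in> P_set S} (\<lambda>n. unit_inv (1 - tp n)) =
          prod_over (P_set (S - {2})) (\<lambda>n. unit_inv (1 - tp n)))
   \<and> (2 \<notin> S \<longrightarrow>
        omega_series (E_series (Lie_S S c)) =
          prod_over (P_set S) (\<lambda>n. unit_inv (1 - tp n))
          * prod_over {n. even n \<and> n div 2 \<in> P_set S} (\<lambda>n. 1 + tp n))
   \<and> (2 \<notin> S \<longrightarrow>
        E_series (omega_alt (Lie_S S c)) =
          prod_over (P_set S) (\<lambda>n. 1 + tp n)
          * prod_over {n. even n \<and> n div 2 \<in> P_set S} (\<lambda>n. unit_inv (1 + tp n)))
   \<and> (2 \<in> S \<longrightarrow>
        E_series (omega_alt (Lie_S S c)) =
          prod_over {n. odd n \<and> n \<in> P_set S} (\<lambda>n. 1 + tp n))"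
proof -
  let ?A = "P_set S" and ?B = "{n. even n \<and> n div 2 \<in> P_set S}" and ?O = "{n. odd n \<and> n \<in> P_set S}"
  have pos: "\<forall>n\<in>?A. n > 0" "\<forall>n\<in>?B. n > 0" "\<forall>n\<in>?O. n > 0"
    by (auto simp: P_set_def intro: gr0I)
  have prod1: "log_deriv (prod_over X (\<lambda>n. unit_inv (1 - tp n))) (pow_sum_log (\<lambda>D r. if D \<in> X then of_nat D else 0))"
    and prod2: "log_deriv (prod_over X (\<lambda>n. 1 - tp n)) (pow_sum_log (\<lambda>D r. if D \<in> X then - of_nat D else 0))"
    and prod3: "log_deriv (prod_over X (\<lambda>n. 1 + tp n)) (pow_sum_log (\<lambda>D r. if D \<in> X then - of_nat D * (-1) ^ r else 0))"
    and prod4: "log_deriv (prod_over X (\<lambda>n. unit_inv (1 + tp n))) (pow_sum_log (\<lambda>D r. if D \<in> X then of_nat D * (-1) ^ r else 0))"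
    if "\<forall>n\<in>X. n > 0" for X
    using that by (auto intro!: log_deriv_prod_over_factors log_deriv_factors)
  have E: "log_deriv (E_series (Lie_S S c)) (pow_sum_log (\<lambda>D r. signed_sum S D))"
    using assms(2) by (rule log_deriv_E_Lie)
  have alt: "log_deriv (E_series (omega_alt (Lie_S S c))) (pow_sum_log (\<lambda>D r. signed_sum S D * (-1) ^ (r - 1)))"
    using assms(2) by (rule log_deriv_E_omega_alt)
  have omega_E: "log_deriv (omega_series (E_series (Lie_S S c)))
      (pow_sum_log (\<lambda>D r. signed_sum S D * (-1) ^ ((D - 1) * r)))"
    using log_deriv_omega_series[OF E] by (simp add: omega_pow_sum_log omega_signed_sum)
  \<comment> \<open>For \<open>2 \<notin> S\<close> all members of \<open>?A\<close> are odd, so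
    \<open>omega\<close> leaves their terms alone. The members of \<open>?B\<close> are even, and
    their terms get the sign \<open>(-1)^r\<close>, which turns \<open>1 - tp n\<close> into
    \<open>1 + tp n\<close>.\<close>
  have oddA: "odd n" if "2 \<notin> S" "n \<in> ?A" for n
    using that two_is_prime_nat by (auto simp: P_set_def)
  \<comment> \<open>The sign \<open>(-1)^(r-1)\<close> turns the logarithmic derivative of
    \<open>unit_inv (1 - tp n)\<close> into that of \<open>1 + tp n\<close>, and that of
    \<open>1 - tp n\<close> into that of \<open>unit_inv (1 + tp n)\<close>.\<close>
  have sgn: "(-1) ^ (r - Suc 0) = - ((-1) ^ r :: symfun)" if "r > 0" for r
    using that by (cases r) simp_all
  have sgn2: "(-1) ^ ((D - Suc 0) * r) = (if odd D then 1 else (-1) ^ r :: symfun)" if "D > 0" for D r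
    using that by (simp add: minus_one_power_iff)
  have "E_series (Lie_S S c) =
      prod_over ?A (\<lambda>n. unit_inv (1 - tp n)) * prod_over ?B (\<lambda>n. 1 - tp n)"
    using log_deriv_mult[OF prod1[OF pos(1)] prod2[OF pos(2)]]
    unfolding pow_sum_log_add by (rule log_deriv_unique_pow_sum_log[OF E]) (auto simp: signed_sum_eq)
  moreover have "E_series (Lie_S S c) = prod_over ?O (\<lambda>n. unit_inv (1 - tp n))" if "2 \<in> S"
    using prod1[OF pos(3)]
    by (rule log_deriv_unique_pow_sum_log[OF E]) (auto simp: signed_sum_eq P_set_even_iff[OF that])
  moreover have "?O = P_set (S - {2})"
  proof -
    have "odd n" if "n \<in> P_set (S - {2})" for n
      using that two_is_prime_nat unfolding P_set_def by blast
    then show ?thesis by (auto simp: P_set_def)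
  qed
  moreover have "omega_series (E_series (Lie_S S c)) =
      prod_over ?A (\<lambda>n. unit_inv (1 - tp n)) * prod_over ?B (\<lambda>n. 1 + tp n)" if "2 \<notin> S"
    using log_deriv_mult[OF prod1[OF pos(1)] prod3[OF pos(2)]]
    unfolding pow_sum_log_add
    by (rule log_deriv_unique_pow_sum_log[OF omega_E]) (use oddA[OF that] in \<open>auto simp: signed_sum_eq sgn2\<close>)
  moreover have "E_series (omega_alt (Lie_S S c)) =
      prod_over ?A (\<lambda>n. 1 + tp n) * prod_over ?B (\<lambda>n. unit_inv (1 + tp n))"
    using log_deriv_mult[OF prod3[OF pos(1)] prod4[OF pos(2)]]
    unfolding pow_sum_log_add
    by (rule log_deriv_unique_pow_sum_log[OF alt]) (auto simp: signed_sum_eq sgn)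
  moreover have "E_series (omega_alt (Lie_S S c)) = prod_over ?O (\<lambda>n. 1 + tp n)" if "2 \<in> S"
    using prod3[OF pos(3)]
    by (rule log_deriv_unique_pow_sum_log[OF alt]) (auto simp: signed_sum_eq sgn P_set_even_iff[OF that])
  ultimately show ?thesis by auto
qed

end
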